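(* Let $p=\sum_{\alpha}p(\alpha)z^\alpha\in\mathbb{C}[T]$, let $\mathcal{N}\subset\mathbb{Z}^d$ be a finite set containing $\{\alpha\in\mathbb{Z}^d: p(\alpha)\neq0\}$, and write $p=\boldsymbol{p}\cdot\boldsymbol{x}$ with the row vector $\boldsymbol{p}=[p(\alpha):\alpha\in\mathcal{N}]\in\mathbb{C}^{|\mathcal{N}|}$ and the column vector $\boldsymbol{x}=[z^\alpha:\alpha\in\mathcal{N}]^T$. Assume $p_\chi(\boldsymbol{1})=m^{-1}$ for all $\chi\in G'$. The following conditions are equivalent. (i) There exist row vectors $\boldsymbol{q}_j=[q_j(\alpha):\alpha\in\mathcal{N}]\in\mathbb{C}^{|\mathcal{N}|}$, $1\le j\le N$, satisfying $$\boldsymbol{x}^*E_\chi\Bigl(\operatorname{diag}(\operatorname{Re}\boldsymbol{p})-\boldsymbol{p}^*\boldsymbol{p}-\sum_{j=1}^N\boldsymbol{q}_j^*\boldsymbol{q}_j\Bigr)E_\eta\,\boldsymbol{x}=0\qquad\text{for all }\chi,\eta\in G'.$$ (ii) There exist row vectors $\boldsymbol{q}_j\in\mathbb{C}^{|\mathcal{N}|}$, $1\le j\le N$, such that the Laurent polynomials $q_j=\boldsymbol{q}_j\cdot\boldsymbol{x}\in\mathbb{C}[T]$ satisfy $$\delta_{\sigma,\tau}-p^{\sigma*}p^{\tau}=\sum_{j=1}^N q_j^{\sigma*}q_j^{\tau}\qquad\text{for all }\sigma,\tau\in G.$$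
   Context: Let $d\in\mathbb{N}$ and $\mathbb{C}[T]=\mathbb{C}[z_1^{\pm1},\dots,z_d^{\pm1}]$ be the ring of complex Laurent polynomials, with the involution $*$ given by $z_j^*=z_j^{-1}$ and complex conjugation on coefficients. Laurent polynomials are identified with trigonometric polynomials via $z=\boldsymbol{e}^{-i\omega}=(e^{-i\omega_1},\dots,e^{-i\omega_d})$, $\omega\in\mathbb{R}^d$; $\boldsymbol{1}=(1,\dots,1)$. Let $M\in\mathbb{Z}^{d\times d}$ be expansive (all eigenvalues have modulus strictly larger than $1$), $m=|\det M|$, $G=2\pi M^{-T}\mathbb{Z}^d/2\pi\mathbb{Z}^d$ (a finite abelian group of order $m$), and $G'=\mathbb{Z}^d/M\mathbb{Z}^d$. For $p\in\mathbb{C}[T]$ and $\sigma\in G$, $p^\sigma\in\mathbb{C}[T]$ is defined by $p^\sigma(\boldsymbol{e}^{-i\omega})=p(\boldsymbol{e}^{-i(\omega+\sigma)})$, and $p^{\sigma*}=(p^\sigma)^*$. For $\chi\in G'$, the isotypical component of $p=\sum_\alpha p(\alpha)z^\alpha$ is $p_\chi=\sum_{\alpha\in\chi}p(\alpha)z^\alpha$, where $\chi\in G'$ is regarded as a coset of $M\mathbb{Z}^d$. For complex row vectors, $*$ denotes the conjugate transpose, and $\boldsymbol{x}^*=[z^{-\alpha}:\alpha\in\mathcal{N}]$ is a row vector. $E_\chi\in\mathbb{R}^{|\mathcal{N}|\times|\mathcal{N}|}$ is the diagonal matrix with $E_\chi(\alpha,\alpha)=1$ if $\alpha\equiv\chi\bmod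 M\mathbb{Z}^d$ and $E_\chi(\alpha,\alpha)=0$ otherwise, $\alpha\in\mathcal{N}$. $\operatorname{diag}(\operatorname{Re}\boldsymbol{p})$ is the diagonal matrix with diagonal entries $\operatorname{Re}(p(\alpha))$, $\alpha\in\mathcal{N}$. $\delta_{\sigma,\tau}$ is the Kronecker delta. *)

theory Defs
  imports "HOL-Analysis.Analysis" "HOL-Library.Poly_Mapping"
begin

text \<open>
  The Laurent polynomial ring in d variables is the group ring of the lattice of
  integer vectors: finitely supported coefficient functions with the convolution product.
\<close>

type_synonym 'd laurent = "(int ^ 'd) \<Rightarrow>\<^sub>0 complex"

abbreviation lcoeff :: "'d::finite laurent \<Rightarrow> int ^ 'd \<Rightarrow> complex" where
  "lcoeff \<equiv> Poly_Mapping.lookup"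

definition lmonom :: "int ^ 'd::finite \<Rightarrow> 'd laurent" where
  "lmonom \<alpha> = Poly_Mapping.single \<alpha> 1"

definition lconst :: "complex \<Rightarrow> 'd::finite laurent" where
  "lconst c = Poly_Mapping.single 0 c"

definition lstar :: "'d::finite laurent \<Rightarrow> 'd laurent" where
  "lstar p = Poly_Mapping.map cnj (Poly_Mapping.map_key uminus p)"

lemma lcoeff_lstar: "lcoeff (lstar p) \<alpha> = cnj (lcoeff p (- \<alpha>))"
  by (simp add: lstar_def Poly_Mapping.map.rep_eq Poly_Mapping.map_key.rep_eq when_def)

definition leval :: "'d::finite laurent \<Rightarrow> complex ^ 'd \<Rightarrow> complex" where
  "leval p z = (\<Sum>\<alpha>\<in>Poly_Mapping.keys p. lcoeff p \<alpha> * (\<Prod>j\<in>UNIV. (z $ j) powi (\<alpha> $ j)))"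

definition torus :: "real ^ 'd::finite \<Rightarrow> complex ^ 'd" where
  "torus \<omega> = (\<chi> j. exp (- \<i> * complex_of_real (\<omega> $ j)))"

definition expansive :: "int ^ 'd ^ 'd::finite \<Rightarrow> bool" where
  "expansive M \<longleftrightarrow>
     (\<forall>(l::complex) (v::complex ^ 'd).
        v \<noteq> 0 \<and> map_matrix complex_of_int M *v v = l *s v \<longrightarrow> cmod l > 1)"

definition int_lattice :: "(real ^ 'd::finite) set" where
  "int_lattice = range (\<lambda>k::int ^ 'd. \<chi> j. real_of_int (k $ j))"

text \<open>The groups G and G' as sets of cosets.\<close>

definition grpG :: "int ^ 'd ^ 'd::finite \<Rightarrow> (real ^ 'd) set set" where
  "grpG M =
     {(2 * pi) *\<^sub>R (transpose (matrix_inv (map_matrix real_of_int M)) *v k) | k. k \<in> int_lattice}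
       // {(s, t). \<exists>k\<in>int_lattice. s - t = (2 * pi) *\<^sub>R k}"

definition grpG' :: "int ^ 'd ^ 'd::finite \<Rightarrow> (int ^ 'd) set set" where
  "grpG' M = UNIV // {(\<alpha>, \<beta>). \<exists>k. \<alpha> - \<beta> = M *v k}"

text \<open>
  The shifted polynomial is the unique Laurent polynomial whose values on the torus are
  shifted by the coset; see lemmas lshift_ex1 and lcoeff_lshift below.
\<close>

definition lshift :: "'d::finite laurent \<Rightarrow> (real ^ 'd) set \<Rightarrow> 'd laurent" where
  "lshift p \<sigma> = (THE q. \<forall>\<omega>. \<forall>s\<in>\<sigma>. leval q (torus \<omega>) = leval p (torus (\<omega> + s)))"

definition isotyp :: "'d::finite laurent \<Rightarrow> (int ^ 'd) set \<Rightarrow> 'd laurent" where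
  "isotyp p \<kappa> = (\<Sum>\<alpha>\<in>Poly_Mapping.keys p \<inter> \<kappa>. Poly_Mapping.single \<alpha> (lcoeff p \<alpha>))"

text \<open>
  Row vectors and square matrices indexed by a finite set S of exponents are functions on
  all exponents, of which only the values on S are ever used.
\<close>

definition vdot :: "(int ^ 'd::finite) set \<Rightarrow> (int ^ 'd \<Rightarrow> complex) \<Rightarrow> 'd laurent" where
  "vdot S v = (\<Sum>\<alpha>\<in>S. lconst (v \<alpha>) * lmonom \<alpha>)"

definition diagm :: "('i \<Rightarrow> complex) \<Rightarrow> 'i \<Rightarrow> 'i \<Rightarrow> complex" where
  "diagm f \<alpha> \<beta> = (if \<alpha> = \<beta> then f \<alpha> else 0)"

definition Emat :: "'i set \<Rightarrow> 'i \<Rightarrow> 'i \<Rightarrow> complex" where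
  "Emat \<kappa> = diagm (\<lambda>\<alpha>. if \<alpha> \<in> \<kappa> then 1 else 0)"

text \<open>The conjugate transpose of the row vector v, times v.\<close>

definition gram :: "('i \<Rightarrow> complex) \<Rightarrow> 'i \<Rightarrow> 'i \<Rightarrow> complex" where
  "gram v \<alpha> \<beta> = cnj (v \<alpha>) * v \<beta>"

definition mmult :: "'i set \<Rightarrow> ('i \<Rightarrow> 'i \<Rightarrow> complex) \<Rightarrow> ('i \<Rightarrow> 'i \<Rightarrow> complex) \<Rightarrow> 'i \<Rightarrow> 'i \<Rightarrow> complex" where
  "mmult S A B \<alpha> \<beta> = (\<Sum>\<gamma>\<in>S. A \<alpha> \<gamma> * B \<gamma> \<beta>)"

text \<open>The Laurent polynomial x* A x, where x is the column of the monomials with exponents in S.\<close>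

definition xform :: "(int ^ 'd::finite) set \<Rightarrow> (int ^ 'd \<Rightarrow> int ^ 'd \<Rightarrow> complex) \<Rightarrow> 'd laurent" where
  "xform S A = (\<Sum>\<alpha>\<in>S. \<Sum>\<beta>\<in>S. lmonom (- \<alpha>) * lconst (A \<alpha> \<beta>) * lmonom \<beta>)"

definition trig :: "int ^ 'd::finite \<Rightarrow> real ^ 'd \<Rightarrow> complex" where
  "trig \<alpha> \<omega> = exp (- \<i> * complex_of_real (\<Sum>j\<in>UNIV. of_int (\<alpha> $ j) * \<omega> $ j))"

lemma trig_add: "trig \<alpha> (\<omega> + s) = trig \<alpha> \<omega> * trig \<alpha> s"
  unfolding trig_def
  by (simp add: algebra_simps sum.distrib flip: exp_add)

lemma trig_nz: "trig \<alpha> \<omega> \<noteq> 0"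
  by (simp add: trig_def)

lemma leval_torus:
  "leval p (torus \<omega>) = (\<Sum>\<alpha>\<in>Poly_Mapping.keys p. lcoeff p \<alpha> * trig \<alpha> \<omega>)"
proof -
  have "(\<Prod>j\<in>UNIV. (torus \<omega> $ j) powi (\<alpha> $ j)) = trig \<alpha> \<omega>" for \<alpha> :: "int ^ 'a"
    by (simp add: torus_def trig_def exp_power_int sum_distrib_left mult_ac
        flip: exp_sum sum_negf)
  then show ?thesis
    by (simp add: leval_def)
qed

lemma trig_separates:
  assumes "\<alpha> \<noteq> \<beta>"
  shows "\<exists>s. trig \<alpha> s \<noteq> trig \<beta> s"
proof -
  obtain j where j: "\<alpha> $ j \<noteq> \<beta> $ j"
    using assms by (auto simp: vec_eq_iff)
  define t where "t = pi / real_of_int (\<alpha> $ j - \<beta> $ j)"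
  define s :: "real ^ 'a" where "s = axis j t"
  have sum: "(\<Sum>i\<in>UNIV. of_int (\<gamma> $ i) * s $ i) = of_int (\<gamma> $ j) * t" for \<gamma>
    by (simp add: s_def axis_def if_distrib cong: if_cong)
  have "real_of_int (\<alpha> $ j - \<beta> $ j) * t = pi"
    using j unfolding t_def by (simp del: of_int_diff)
  then have eq: "real_of_int (\<alpha> $ j) * t = pi + real_of_int (\<beta> $ j) * t"
    by (simp add: left_diff_distrib)
  have "trig \<alpha> s = exp (- (\<i> * complex_of_real pi)) * trig \<beta> s"
    unfolding trig_def sum eq of_real_add exp_add[symmetric] by (simp add: ring_distribs)
  then have "trig \<alpha> s = - trig \<beta> s"
    by (simp add: exp_minus)
  then show ?thesis
    using trig_nz[of \<beta> s] by (intro exI[of _ s]) simp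
qed

lemma trig_independent:
  assumes "finite K" "\<And>\<omega>. (\<Sum>\<alpha>\<in>K. c \<alpha> * trig \<alpha> \<omega>) = 0" "\<alpha> \<in> K"
  shows "c \<alpha> = 0"
  using assms
proof (induction K arbitrary: c \<alpha> rule: finite_induct)
  case empty
  then show ?case by simp
next
  case (insert a K)
  have f: "c a * trig a \<omega> + (\<Sum>\<beta>\<in>K. c \<beta> * trig \<beta> \<omega>) = 0" for \<omega>
    using insert.prems(1)[of \<omega>] insert.hyps by simp
  have "c \<beta> * (trig \<beta> s - trig a s) = 0" if "\<beta> \<in> K" for \<beta> s
  proof (rule insert.IH[OF _ that])
    fix \<omega>
    have "(\<Sum>\<beta>\<in>K. c \<beta> * (trig \<beta> s - trig a s) * trig \<beta> \<omega>)
        = (\<Sum>\<beta>\<in>K. c \<beta> * trig \<beta> (\<omega> + s)) - trig a s * (\<Sum>\<beta>\<in>K. c \<beta> * trig \<beta> \<omega>)"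
      by (simp add: trig_add sum_distrib_left algebra_simps sum_subtractf)
    also have "(\<Sum>\<beta>\<in>K. c \<beta> * trig \<beta> (\<omega> + s)) = - (c a * trig a (\<omega> + s))"
      using f[of "\<omega> + s"] by (simp add: eq_neg_iff_add_eq_0 add.commute)
    also have "(\<Sum>\<beta>\<in>K. c \<beta> * trig \<beta> \<omega>) = - (c a * trig a \<omega>)"
      using f[of \<omega>] by (simp add: eq_neg_iff_add_eq_0 add.commute)
    finally show "(\<Sum>\<beta>\<in>K. c \<beta> * (trig \<beta> s - trig a s) * trig \<beta> \<omega>) = 0"
      by (simp add: trig_add)
  qed
  then have K: "c \<beta> = 0" if "\<beta> \<in> K" for \<beta>
    using that trig_separates[of \<beta> a] insert.hyps(2) by fastforce
  with f[of 0] have "c a = 0"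
    using trig_nz[of a 0] by simp
  with K insert.prems(2) show ?case by auto
qed

lemma leval_torus_inj:
  assumes "\<And>\<omega>. leval p (torus \<omega>) = leval q (torus \<omega>)"
  shows "p = q"
proof (rule poly_mapping_eqI)
  fix \<alpha>
  let ?K = "Poly_Mapping.keys p \<union> Poly_Mapping.keys q"
  have ext: "leval r (torus \<omega>) = (\<Sum>\<beta>\<in>?K. lcoeff r \<beta> * trig \<beta> \<omega>)"
    if "Poly_Mapping.keys r \<subseteq> ?K" for r \<omega>
    unfolding leval_torus using that
    by (intro sum.mono_neutral_left) (auto simp: in_keys_iff)
  have z: "(\<Sum>\<beta>\<in>?K. (lcoeff p \<beta> - lcoeff q \<beta>) * trig \<beta> \<omega>) = 0" for \<omega>
    using assms[of \<omega>] by (simp add: ext algebra_simps sum_subtractf)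
  show "lcoeff p \<alpha> = lcoeff q \<alpha>"
  proof (cases "\<alpha> \<in> ?K")
    case True
    then show ?thesis
      using trig_independent[of ?K "\<lambda>\<beta>. lcoeff p \<beta> - lcoeff q \<beta>" \<alpha>] z by simp
  next
    case False
    then show ?thesis by (auto simp: in_keys_iff)
  qed
qed

lemma trig_period:
  assumes "s - t = (2 * pi) *\<^sub>R k" "k \<in> int_lattice"
  shows "trig \<alpha> s = trig \<alpha> t"
proof -
  obtain n :: "int ^ 'a" where n: "k = (\<chi> j. real_of_int (n $ j))"
    using assms(2) by (auto simp: int_lattice_def)
  have s: "s = t + (2 * pi) *\<^sub>R k"
    using assms(1) by (simp add: algebra_simps)
  have "(\<Sum>j\<in>UNIV. of_int (\<alpha> $ j) * ((2 * pi) *\<^sub>R k) $ j)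
      = 2 * pi * of_int (\<Sum>j\<in>UNIV. \<alpha> $ j * n $ j)"
    by (simp add: n sum_distrib_left mult_ac)
  then have "trig \<alpha> ((2 * pi) *\<^sub>R k)
      = exp ((2 * of_int (- (\<Sum>j\<in>UNIV. \<alpha> $ j * n $ j)) * pi) * \<i>)"
    unfolding trig_def by (simp only: of_real_mult of_real_of_int_eq) (simp add: mult_ac)
  also have "\<dots> = 1"
    by (rule exp_integer_2pi) (rule Ints_of_int)
  finally show ?thesis
    by (simp add: s trig_add)
qed

lemma grpG_coset:
  assumes "\<sigma> \<in> grpG M" "s \<in> \<sigma>" "t \<in> \<sigma>"
  shows "trig \<alpha> s = trig \<alpha> t"
proof -
  obtain a where "\<sigma> = {(s, t). \<exists>k\<in>int_lattice. s - t = (2 * pi) *\<^sub>R k} `` {a}"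
    using assms(1) by (auto simp: grpG_def elim: quotientE)
  with assms(2,3) have "trig \<alpha> a = trig \<alpha> s" "trig \<alpha> a = trig \<alpha> t"
    by (auto intro: trig_period)
  then show ?thesis by simp
qed

lemma grpG_nonempty:
  assumes "\<sigma> \<in> grpG M"
  shows "\<sigma> \<noteq> {}"
proof -
  obtain a where "\<sigma> = {(s, t). \<exists>k\<in>int_lattice. s - t = (2 * pi) *\<^sub>R k} `` {a}"
    using assms by (auto simp: grpG_def elim: quotientE)
  moreover have "(0 :: real ^ 'a) \<in> int_lattice"
    unfolding int_lattice_def by (rule image_eqI[of _ _ 0]) (simp_all add: vec_eq_iff)
  ultimately show ?thesis
    by (auto intro!: exI[of _ a] bexI[of _ 0])
qed

lemma
  assumes "\<sigma> \<in> grpG M"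
  shows lshift_ex1: "\<exists>!q. \<forall>\<omega>. \<forall>s\<in>\<sigma>. leval q (torus \<omega>) = leval p (torus (\<omega> + s))"
    and lcoeff_lshift: "s \<in> \<sigma> \<Longrightarrow> lcoeff (lshift p \<sigma>) \<alpha> = trig \<alpha> s * lcoeff p \<alpha>"
proof -
  let ?P = "\<lambda>q. \<forall>\<omega>. \<forall>s\<in>\<sigma>. leval q (torus \<omega>) = leval p (torus (\<omega> + s))"
  have unique: "q = q'" if "?P q" "?P q'" for q q'
    using that grpG_nonempty[OF assms] by (auto intro!: leval_torus_inj)
  obtain t where t: "t \<in> \<sigma>"
    using grpG_nonempty[OF assms] by blast
  define r where "r = Poly_Mapping.mapp (\<lambda>\<beta> c. trig \<beta> t * c) p"
  have r: "lcoeff r \<beta> = trig \<beta> t * lcoeff p \<beta>" for \<beta>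
    by (auto simp: r_def lookup_mapp when_def in_keys_iff)
  have keys: "Poly_Mapping.keys r = Poly_Mapping.keys p"
    by (auto simp: in_keys_iff r trig_nz)
  have Pr: "?P r"
  proof (intro allI ballI)
    fix \<omega> s
    assume s: "s \<in> \<sigma>"
    show "leval r (torus \<omega>) = leval p (torus (\<omega> + s))"
      unfolding leval_torus keys r trig_add
      by (rule sum.cong) (simp_all add: grpG_coset[OF assms t s] mult_ac)
  qed
  show "\<exists>!q. ?P q"
    using Pr unique by blast
  have "lshift p \<sigma> = r"
    unfolding lshift_def by (rule the_equality) (use Pr unique in auto)
  then show "lcoeff (lshift p \<sigma>) \<alpha> = trig \<alpha> s * lcoeff p \<alpha>" if "s \<in> \<sigma>"
    using r[of \<alpha>] grpG_coset[OF assms t that, of \<alpha>] by simp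
qed

end

theory Submission
  imports Defs
begin

text \<open>
  Put $r_0 = p$ and $r_j = q_j$ for $j \ge 1$. Since $z^{-\alpha} z^{\alpha} = 1$, the diagonal matrix
  contributes to $x^* E_\chi (\ldots) E_\eta x$ the constant
  $\delta_{\chi,\eta} \sum_{\alpha \in \chi} \mathrm{Re}\, p(\alpha)$, which the normalisation
  $p_\chi(1) = 1/m$ turns into $\delta_{\chi,\eta}/m$; every other summand is a product of isotypical
  components. So the first condition says $\sum_j r_{j,\chi}^* r_{j,\eta} = \delta_{\chi,\eta}/m$ and the
  second says $\sum_j r_j^{\sigma *} r_j^{\tau} = \delta_{\sigma,\tau}$.

  A monomial with exponent in the coset $\chi$ is multiplied by $\chi(\sigma) = e^{-i \alpha \cdot \sigma}$,
  $\alpha \in \chi$, when the argument is shifted by $\sigma$, so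
  $r^\sigma = \sum_\chi \chi(\sigma) r_\chi$ (\<open>lshift_vdot\<close>). Up to the factor $\sqrt m$ the matrix
  $(\chi(\sigma))$ is unitary; conjugating with it turns either system of equations into the other
  (\<open>fourier_inversion\<close>), and the same vectors $q_j$ serve on both sides.

  Unitarity means orthogonality of the rows and of the columns
  (\<open>character_orthogonality_G\<close>, \<open>character_orthogonality_G'\<close>), both with the constant $m = |\det M|$. Off
  the diagonal it holds because the pairing of the two groups is nondegenerate and a nontrivial character
  sums to zero. On the diagonal it says that both groups have order $|\det M|$. For
  $\mathbb{Z}^d / M \mathbb{Z}^d$ this is a comparison of volumes (\<open>card_lattice_cosets\<close>): the linear image of
  the unit cube under $M$, and the union of the unit cubes at a system of coset representatives, are both
  fundamental domains of the lattice $M \mathbb{Z}^d$. The other group is isomorphic to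
  $\mathbb{Z}^d / M^T \mathbb{Z}^d$, which reduces its order to the same count for $M^T$.
\<close>

section \<open>Cosets and character sums\<close>

definition add_subgroup :: "'a::ab_group_add set \<Rightarrow> bool" where
  "add_subgroup H \<longleftrightarrow> 0 \<in> H \<and> (\<forall>x\<in>H. \<forall>y\<in>H. x - y \<in> H)"

definition coset_rel :: "'a::ab_group_add set \<Rightarrow> ('a \<times> 'a) set" where
  "coset_rel H = {(x, y). x - y \<in> H}"

text \<open>
  Functions on a quotient are evaluated at an arbitrarily chosen element of each coset.
\<close>

definition rep :: "'a set \<Rightarrow> 'a" where
  "rep c = (SOME x. x \<in> c)"

lemma add_subgroup_uminus: "add_subgroup H \<Longrightarrow> x \<in> H \<Longrightarrow> - x \<in> H"
  unfolding add_subgroup_def by (metis diff_0)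

lemma add_subgroup_add: "add_subgroup H \<Longrightarrow> x \<in> H \<Longrightarrow> y \<in> H \<Longrightarrow> x + y \<in> H"
  using add_subgroup_uminus[of H y] unfolding add_subgroup_def
  by (metis diff_minus_eq_add)

lemma equiv_coset_rel:
  assumes "add_subgroup H"
  shows "equiv UNIV (coset_rel H)"
proof (rule equivI)
  show "refl (coset_rel H)"
    using assms by (auto simp: refl_on_def coset_rel_def add_subgroup_def)
  show "sym (coset_rel H)"
    using add_subgroup_uminus[OF assms] by (fastforce simp: sym_def coset_rel_def)
  show "trans (coset_rel H)"
    using add_subgroup_add[OF assms] by (fastforce simp: trans_def coset_rel_def)
qed simp

lemma coset_in_quotient_UNIV: "c \<in> A // coset_rel H \<Longrightarrow> c \<in> UNIV // coset_rel H"
  by (auto simp: quotient_def)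

lemma rep_in_coset:
  assumes "add_subgroup H" "c \<in> A // coset_rel H"
  shows "rep c \<in> c"
proof -
  have "c \<noteq> {}"
    using in_quotient_imp_non_empty[OF equiv_coset_rel[OF assms(1)]]
      coset_in_quotient_UNIV[OF assms(2)] by blast
  then show ?thesis
    unfolding rep_def by (simp add: some_in_eq)
qed

lemma coset_eq_iff:
  assumes "add_subgroup H" "c \<in> A // coset_rel H" "c' \<in> A // coset_rel H" "x \<in> c" "y \<in> c'"
  shows "c = c' \<longleftrightarrow> x - y \<in> H"
  using quotient_eq_iff[OF equiv_coset_rel[OF assms(1)] coset_in_quotient_UNIV[OF assms(2)]
      coset_in_quotient_UNIV[OF assms(3)] assms(4,5)]
  by (simp add: coset_rel_def)

lemma translate_coset: "(+) a ` (coset_rel H `` {x}) = coset_rel H `` {a + x}"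
proof -
  have "y \<in> (+) a ` (coset_rel H `` {x})" if "y \<in> coset_rel H `` {a + x}" for y
    using that by (intro image_eqI[of _ _ "y - a"]) (auto simp: coset_rel_def algebra_simps)
  then show ?thesis
    by (auto simp: coset_rel_def algebra_simps)
qed

text \<open>
  The classical shift argument: translation by \<open>a\<close> permutes the cosets and multiplies the sum by
  \<open>f a \<noteq> 1\<close>. Taking \<open>A // coset_rel H\<close> as the group covers both $\mathbb{Z}^d / M\mathbb{Z}^d$ and $G$.
\<close>

lemma character_sum:
  fixes f :: "'a::ab_group_add \<Rightarrow> complex"
  assumes A: "add_subgroup A" and H: "add_subgroup H"
    and mult: "\<And>x y. f (x + y) = f x * f y"
    and triv: "\<And>h. h \<in> H \<Longrightarrow> f h = 1"
    and a: "a \<in> A" "f a \<noteq> 1"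
  shows "(\<Sum>c\<in>A // coset_rel H. f (rep c)) = 0"
proof -
  let ?Q = "A // coset_rel H"
  have const: "f x = f y" if "c \<in> ?Q" "x \<in> c" "y \<in> c" for c x y
  proof -
    have "x - y \<in> H"
      using coset_eq_iff[OF H that(1) that(1) that(2,3)] by simp
    then show ?thesis
      using mult[of "x - y" y] triv[of "x - y"] by simp
  qed
  have into: "(+) b ` c \<in> ?Q" if "c \<in> ?Q" "b \<in> A" for c b
  proof -
    obtain x where "x \<in> A" "c = coset_rel H `` {x}"
      using \<open>c \<in> ?Q\<close> by (rule quotientE)
    then show ?thesis
      using add_subgroup_add[OF A \<open>b \<in> A\<close>] by (simp add: translate_coset quotientI)
  qed
  have bij: "bij_betw (image ((+) a)) ?Q ?Q"
    by (rule bij_betw_byWitness[where f' = "image ((+) (- a))"])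
      (use into[OF _ a(1)] into[OF _ add_subgroup_uminus[OF A a(1)]] in
        \<open>auto simp: image_image\<close>)
  have "(\<Sum>c\<in>?Q. f (rep c)) = (\<Sum>c\<in>?Q. f (rep ((+) a ` c)))"
    using sum.reindex_bij_betw[OF bij, of "\<lambda>c. f (rep c)"] by simp
  also have "\<dots> = (\<Sum>c\<in>?Q. f a * f (rep c))"
  proof (rule sum.cong)
    fix c assume c: "c \<in> ?Q"
    show "f (rep ((+) a ` c)) = f a * f (rep c)"
      using const[OF into[OF c a(1)] rep_in_coset[OF H into[OF c a(1)]], of "a + rep c"]
        rep_in_coset[OF H c] by (simp add: mult)
  qed simp
  also have "\<dots> = f a * (\<Sum>c\<in>?Q. f (rep c))"
    by (simp add: sum_distrib_left)
  finally show ?thesis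
    using a(2) by simp
qed

section \<open>Volumes of fundamental domains and the index of a sublattice\<close>

text \<open>
  The translates of \<open>D\<close> by elements of \<open>L\<close> partition the space, that is, \<open>D\<close> is a fundamental domain of \<open>L\<close>.
\<close>

definition tiles :: "'a::ab_group_add set \<Rightarrow> 'a set \<Rightarrow> bool" where
  "tiles L D \<longleftrightarrow> (\<forall>x. \<exists>!l. l \<in> L \<and> x - l \<in> D)"

lemma emeasure_lebesgue_translate:
  fixes S :: "'a::euclidean_space set"
  shows "emeasure lebesgue ((+) a ` S) = emeasure lebesgue S"
  using emeasure_lebesgue_affine[of 1 a S] by (simp add: add.commute[of a])

lemma emeasure_split_by_tiles:
  fixes A :: "'a::euclidean_space set"
  assumes "countable L" "tiles L B" "A \<in> sets lebesgue" "B \<in> sets lebesgue"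
  shows "emeasure lebesgue A = (\<integral>\<^sup>+l. emeasure lebesgue (A \<inter> (+) l ` B) \<partial>count_space L)"
proof -
  have shift: "x \<in> (+) l ` B \<longleftrightarrow> x - l \<in> B" for x l
    by (metis add_diff_cancel_left' diff_add_cancel add.commute image_iff)
  have "A = (\<Union>l\<in>L. A \<inter> (+) l ` B)"
    using assms(2) unfolding tiles_def by (auto simp: shift) blast
  moreover have "disjoint_family_on (\<lambda>l. A \<inter> (+) l ` B) L"
  proof -
    have "l = l'" if "l \<in> L" "l' \<in> L" "x \<in> (+) l ` B" "x \<in> (+) l' ` B" for l l' x
      using assms(2) that unfolding tiles_def shift by blast
    then show ?thesis
      unfolding disjoint_family_on_def by blast
  qed
  ultimately show ?thesis
    using emeasure_UN_countable[of L "\<lambda>l. A \<inter> (+) l ` B" lebesgue] assms(1,3,4)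
      lebesgue_sets_translation[OF assms(4)] by auto
qed

text \<open>
  Cutting \<open>A\<close> along the translates of \<open>B\<close> and cutting \<open>B\<close> along the translates of \<open>A\<close> produces the same
  pieces up to translation: \<open>A \<inter> (l + B)\<close> is moved onto \<open>B \<inter> (A - l)\<close> by \<open>- l\<close>.
\<close>

lemma tiles_emeasure_eq:
  fixes A B :: "'a::euclidean_space set"
  assumes "countable L" "add_subgroup L" "tiles L A" "tiles L B"
    "A \<in> sets lebesgue" "B \<in> sets lebesgue"
  shows "emeasure lebesgue A = emeasure lebesgue B"
proof -
  have bij: "bij_betw uminus L L"
    by (rule bij_betw_byWitness[where f' = uminus])
      (use add_subgroup_uminus[OF assms(2)] in auto)
  have "emeasure lebesgue (A \<inter> (+) l ` B) = emeasure lebesgue (B \<inter> (+) (- l) ` A)" for l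
  proof -
    have "B \<inter> (+) (- l) ` A = (+) (- l) ` (A \<inter> (+) l ` B)"
      by (simp add: image_Int image_image) blast
    then show ?thesis
      by (simp only: emeasure_lebesgue_translate)
  qed
  then have "emeasure lebesgue A = (\<integral>\<^sup>+l. emeasure lebesgue (B \<inter> (+) (- l) ` A) \<partial>count_space L)"
    using emeasure_split_by_tiles[OF assms(1,4,5,6)] by simp
  also have "\<dots> = (\<integral>\<^sup>+l. emeasure lebesgue (B \<inter> (+) l ` A) \<partial>count_space L)"
    using nn_integral_bij_count_space[OF bij, of "\<lambda>l. emeasure lebesgue (B \<inter> (+) l ` A)"] .
  also have "\<dots> = emeasure lebesgue B"
    using emeasure_split_by_tiles[OF assms(1,3,6,5)] by simp
  finally show ?thesis .
qed

definition of_int_vec :: "int ^ 'd::finite \<Rightarrow> real ^ 'd" where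
  "of_int_vec k = (\<chi> j. real_of_int (k $ j))"

definition half_open_cube :: "(real ^ 'd::finite) set" where
  "half_open_cube = {x. \<forall>j. 0 \<le> x $ j \<and> x $ j < 1}"

definition floor_vec :: "real ^ 'd::finite \<Rightarrow> int ^ 'd" where
  "floor_vec x = (\<chi> j. \<lfloor>x $ j\<rfloor>)"

lemma of_int_vec_nth [simp]: "of_int_vec k $ j = real_of_int (k $ j)"
  by (simp add: of_int_vec_def)

lemma of_int_vec_inject [simp]: "of_int_vec k = of_int_vec l \<longleftrightarrow> k = l"
  by (simp add: vec_eq_iff)

lemma of_int_vec_0 [simp]: "of_int_vec 0 = 0"
  by (simp add: vec_eq_iff)

lemma of_int_vec_add: "of_int_vec (k + l) = of_int_vec k + of_int_vec l"
  by (simp add: vec_eq_iff)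

lemma of_int_vec_diff: "of_int_vec (k - l) = of_int_vec k - of_int_vec l"
  by (simp add: vec_eq_iff)

lemma of_int_vec_mult: "of_int_vec (M *v k) = map_matrix real_of_int M *v of_int_vec k"
  by (simp add: vec_eq_iff matrix_vector_mult_def)

lemma det_of_int: "det (map_matrix of_int M) = (of_int (det M) :: 'a::comm_ring_1)"
  by (simp add: det_def)

lemma diff_in_cube_iff: "x - of_int_vec k \<in> half_open_cube \<longleftrightarrow> k = floor_vec x"
proof -
  have "0 \<le> x $ j - real_of_int (k $ j) \<and> x $ j - real_of_int (k $ j) < 1 \<longleftrightarrow> k $ j = \<lfloor>x $ j\<rfloor>" for j
    by linarith
  then show ?thesis
    by (simp add: half_open_cube_def floor_vec_def vec_eq_iff)
qed

lemma
  shows lmeasurable_half_open_cube: "(half_open_cube :: (real ^ 'd::finite) set) \<in> lmeasurable"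
    and measure_half_open_cube: "measure lebesgue (half_open_cube :: (real ^ 'd) set) = 1"
proof -
  let ?Q = "half_open_cube :: (real ^ 'd) set" and ?c = "cbox 0 1 :: (real ^ 'd) set"
  have sub: "sym_diff ?c ?Q \<subseteq> ?c - box 0 1"
    by (auto simp: half_open_cube_def mem_box_cart less_imp_le)
  have neg: "negligible (sym_diff ?c ?Q)"
    using negligible_subset[OF negligible_frontier_interval sub] .
  show "?Q \<in> lmeasurable"
    using lmeasurable_negligible_symdiff[OF _ neg] by simp
  have "measure lebesgue ?Q = measure lebesgue ?c"
    using measure_negligible_symdiff[OF _ neg] by simp
  also have "\<dots> = 1"
    using content_cbox_cart[of "0 :: real ^ 'd" 1] by (simp add: interval_ne_empty_cart)
  finally show "measure lebesgue ?Q = 1" .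
qed

lemma add_subgroup_range_mult: "add_subgroup (range ((*v) (M :: int ^ 'd ^ 'd::finite)))"
  by (auto simp: add_subgroup_def image_iff simp flip: matrix_vector_mult_diff_distrib
      intro: exI[of _ 0])

lemma grpG'_coset: "grpG' M = UNIV // coset_rel (range ((*v) M))"
proof -
  have "{(\<alpha>, \<beta>). \<exists>k. \<alpha> - \<beta> = M *v k} = coset_rel (range ((*v) M))"
    by (auto simp: coset_rel_def)
  then show ?thesis
    by (simp only: grpG'_def)
qed

text \<open>
  Elementary maps generate all linear maps. A shear matrix arises from the identity by a row operation and
  so has determinant $1$ for any finite index type; triangularity would need an order on the indices.
\<close>

lemma linear_image_volume:
  fixes f :: "real ^ 'n \<Rightarrow> real ^ 'n"
  assumes "linear f" "S \<in> lmeasurable"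
  shows "f ` S \<in> lmeasurable \<and> measure lebesgue (f ` S) = \<bar>det (matrix f)\<bar> * measure lebesgue S"
proof -
  have boxes: "f ` S \<in> lmeasurable \<and> measure lebesgue (f ` S) = \<bar>det (matrix f)\<bar> * measure lebesgue S"
    if "linear f" "S \<in> lmeasurable" "\<bar>det (matrix f)\<bar> = 1"
      "\<And>a b. cbox a b \<noteq> {} \<Longrightarrow> measure lebesgue (f ` cbox a b) = measure lebesgue (cbox a b)"
    for f :: "real ^ 'n \<Rightarrow> real ^ 'n" and S
  proof -
    have "measure lebesgue (f ` cbox a b) = 1 * measure lebesgue (cbox a b)" for a b
      using that(4)[of a b] by (cases "cbox a b = {}") auto
    from measure_linear_sufficient[OF that(1,2) this] show ?thesis
      using that(3) by simp
  qed
  have "\<forall>S\<in>lmeasurable. f ` S \<in> lmeasurable \<and>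
      measure lebesgue (f ` S) = \<bar>det (matrix f)\<bar> * measure lebesgue S"
  proof (rule induct_linear_elementary[OF assms(1)]; intro ballI)
    fix f g :: "real ^ 'n \<Rightarrow> real ^ 'n" and S :: "(real ^ 'n) set"
    assume "linear f" "linear g" "S \<in> lmeasurable"
      and "\<forall>S\<in>lmeasurable. f ` S \<in> lmeasurable \<and>
        measure lebesgue (f ` S) = \<bar>det (matrix f)\<bar> * measure lebesgue S"
      and "\<forall>S\<in>lmeasurable. g ` S \<in> lmeasurable \<and>
        measure lebesgue (g ` S) = \<bar>det (matrix g)\<bar> * measure lebesgue S"
    then show "(f \<circ> g) ` S \<in> lmeasurable \<and>
        measure lebesgue ((f \<circ> g) ` S) = \<bar>det (matrix (f \<circ> g))\<bar> * measure lebesgue S"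
      by (simp only: image_comp[symmetric] matrix_compose det_mul abs_mult) simp
  next
    fix f :: "real ^ 'n \<Rightarrow> real ^ 'n" and i and S :: "(real ^ 'n) set"
    assume f: "linear f" "\<And>x. f x $ i = 0"
    then have "\<not> surj f"
      by (metis axis_nth one_neq_zero surjD)
    then have "\<not> inj f"
      using f(1) linear_injective_imp_surjective by blast
    then show "f ` S \<in> lmeasurable \<and> measure lebesgue (f ` S) = \<bar>det (matrix f)\<bar> * measure lebesgue S"
      using negligible_linear_singular_image[OF f(1)] det_nz_iff_inj[OF f(1)]
        negligible_iff_measure[of "f ` S"] by auto
  next
    fix c :: "'n \<Rightarrow> real" and S :: "(real ^ 'n) set"
    assume S: "S \<in> lmeasurable"
    show "(\<lambda>x. \<chi> i. c i * x $ i) ` S \<in> lmeasurable \<and>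
        measure lebesgue ((\<lambda>x. \<chi> i. c i * x $ i) ` S)
          = \<bar>det (matrix (\<lambda>x. \<chi> i. c i * x $ i))\<bar> * measure lebesgue S"
      using measurable_stretch[OF S, of c] measure_stretch[OF S, of c]
      by (simp add: matrix_def axis_def det_diagonal)
  next
    fix m n :: 'n and S :: "(real ^ 'n) set"
    let ?t = "Transposition.transpose m n"
    let ?h = "\<lambda>x :: real ^ 'n. \<chi> i. x $ ?t i"
    assume "S \<in> lmeasurable"
    show "?h ` S \<in> lmeasurable \<and> measure lebesgue (?h ` S) = \<bar>det (matrix ?h)\<bar> * measure lebesgue S"
    proof (rule boxes[OF _ \<open>S \<in> lmeasurable\<close>])
      show "linear ?h"
        by (rule linearI) (simp_all add: vec_eq_iff)
      have "matrix ?h = (\<chi> i. mat 1 $ ?t i)"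
        by (simp add: matrix_def mat_def axis_def vec_eq_iff)
      then show "\<bar>det (matrix ?h)\<bar> = 1"
        by (simp add: det_permute_rows[OF permutes_swap_id] sign_swap_id)
      fix a b :: "real ^ 'n"
      assume ne: "cbox a b \<noteq> {}"
      have eq: "?h ` cbox a b = cbox (?h a) (?h b)"
      proof (intro equalityI subsetI)
        fix y assume "y \<in> cbox (?h a) (?h b)"
        then have "?h y \<in> cbox a b"
          by (simp add: mem_box_cart) (metis transpose_involutory)
        moreover have "y = ?h (?h y)"
          by (simp add: vec_eq_iff)
        ultimately show "y \<in> ?h ` cbox a b"
          by (rule rev_image_eqI)
      qed (auto simp: mem_box_cart)
      have "(\<Prod>i\<in>UNIV. b $ ?t i - a $ ?t i) = (\<Prod>i\<in>UNIV. b $ i - a $ i)"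
        using prod.permute[OF permutes_swap_id, of m UNIV n "\<lambda>i. b $ i - a $ i"]
        by (simp add: comp_def)
      moreover have "cbox (?h a) (?h b) \<noteq> {}"
        using ne eq by (metis image_is_empty)
      ultimately show "measure lebesgue (?h ` cbox a b) = measure lebesgue (cbox a b)"
        using content_cbox_cart[OF ne] content_cbox_cart[of "?h a" "?h b"] by (simp add: eq)
    qed
  next
    fix m n :: 'n and S :: "(real ^ 'n) set"
    let ?h = "\<lambda>x :: real ^ 'n. \<chi> i. if i = m then x $ m + x $ n else x $ i"
    assume mn: "m \<noteq> n" and "S \<in> lmeasurable"
    show "?h ` S \<in> lmeasurable \<and> measure lebesgue (?h ` S) = \<bar>det (matrix ?h)\<bar> * measure lebesgue S"
    proof (rule boxes[OF _ \<open>S \<in> lmeasurable\<close>])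
      show lin: "linear ?h"
        by (rule linearI) (auto simp: vec_eq_iff algebra_simps)
      have "matrix ?h = (\<chi> k. if k = m then row m (mat 1) + 1 *s row n (mat 1) else row k (mat 1))"
        by (auto simp: matrix_def row_def mat_def axis_def vec_eq_iff)
      then show "\<bar>det (matrix ?h)\<bar> = 1"
        using det_row_operation[OF mn, of "mat 1" "1 :: real"] by simp
      fix a b :: "real ^ 'n"
      assume ne: "cbox a b \<noteq> {}"
      have tr: "cbox a b = (+) a ` cbox 0 (b - a)"
        using cbox_translation[of a 0 "b - a"] by simp
      then have ne0: "cbox 0 (b - a) \<noteq> {}"
        using ne by auto
      have "?h ` cbox a b = (+) (?h a) ` ?h ` cbox 0 (b - a)"
        unfolding tr image_image using linear_add[OF lin] by (intro image_cong) auto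
      also have "measure lebesgue \<dots> = measure lebesgue (cbox 0 (b - a))"
        using measure_shear_interval[OF mn ne0] by (simp only: measure_translation) simp
      also have "\<dots> = measure lebesgue (cbox a b)"
        by (simp only: tr measure_translation)
      finally show "measure lebesgue (?h ` cbox a b) = measure lebesgue (cbox a b)" .
    qed
  qed
  with assms(2) show ?thesis by blast
qed

text \<open>
  The index of $M \mathbb{Z}^d$ as a volume. The sets \<open>D\<close> (the image of the unit cube) and \<open>C\<close> (one unit cube for
  each coset) are fundamental domains of the same lattice. The first has volume $|\det M|$, the second as many
  units of volume as there are cosets. The count is taken in the extended nonnegative reals, so finiteness
  of the index follows from finiteness of the volume of \<open>D\<close>.
\<close>

lemma
  fixes M :: "int ^ 'd ^ 'd::finite"
  assumes det: "det M \<noteq> 0"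
  shows finite_lattice_cosets: "finite (grpG' M)"
    and card_lattice_cosets: "int (card (grpG' M)) = \<bar>det M\<bar>"
proof -
  define R where "R = map_matrix real_of_int M"
  define L where "L = range (\<lambda>k. of_int_vec (M *v k))"
  define D where "D = (*v) R ` half_open_cube"
  define C where "C = (\<Union>\<kappa>\<in>grpG' M. (+) (of_int_vec (rep \<kappa>)) ` half_open_cube)"
  let ?H = "range ((*v) M)"
  note H = add_subgroup_range_mult[of M]
  have detR: "det R = of_int (det M)"
    by (simp add: R_def det_of_int)
  then have inv: "invertible R"
    using det by (simp add: invertible_det_nz)
  have L: "add_subgroup L"
    unfolding add_subgroup_def L_def
    by (auto simp: image_iff simp flip: of_int_vec_diff matrix_vector_mult_diff_distrib
        intro: exI[of _ 0])
  \<comment> \<open>In the coordinates \<open>y = matrix_inv R *v x\<close> this is the tiling of space by unit cubes.\<close>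
  have tD: "tiles L D"
    unfolding tiles_def
  proof
    fix x :: "real ^ 'd"
    obtain y where x: "x = R *v y"
      using inv by (metis invertible_right_inverse matrix_right_invertible_surjective surjD)
    have "x - of_int_vec (M *v k) \<in> D \<longleftrightarrow> k = floor_vec y" for k
    proof -
      have "x - of_int_vec (M *v k) = R *v (y - of_int_vec k)"
        by (simp add: x of_int_vec_mult R_def matrix_vector_mult_diff_distrib)
      moreover have "inj ((*v) R)"
        using inv by (simp add: inj_matrix_vector_mult)
      ultimately show ?thesis
        unfolding D_def by (simp add: inj_image_mem_iff diff_in_cube_iff)
    qed
    then show "\<exists>!l. l \<in> L \<and> x - l \<in> D"
      unfolding L_def by auto
  qed
  \<comment> \<open>The unit cube containing \<open>x\<close> has corner \<open>floor_vec x\<close>, and a unique lattice vector moves this corner to the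
    representative of its coset.\<close>
  have tC: "tiles L C"
    unfolding tiles_def
  proof
    fix x :: "real ^ 'd"
    let ?n = "floor_vec x" and ?c = "coset_rel ?H `` {floor_vec x}"
    have c: "?c \<in> grpG' M"
      by (simp add: grpG'_coset quotientI)
    have nc: "?n \<in> ?c"
      using H by (simp add: coset_rel_def add_subgroup_def)
    have iff: "x - of_int_vec l \<in> C \<longleftrightarrow> l = ?n - rep ?c" if l: "l \<in> ?H" for l
    proof -
      have "x - of_int_vec l \<in> C \<longleftrightarrow> (\<exists>\<kappa>\<in>grpG' M. l = ?n - rep \<kappa>)"
      proof -
        have "x - of_int_vec l \<in> (+) (of_int_vec r) ` half_open_cube \<longleftrightarrow> l = ?n - r" for r
        proof -
          have "x - of_int_vec l \<in> (+) (of_int_vec r) ` half_open_cube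
              \<longleftrightarrow> x - of_int_vec (l + r) \<in> half_open_cube"
            unfolding of_int_vec_add
            by (metis (no_types, lifting) add_diff_cancel_left' diff_add_cancel diff_diff_eq
                add.commute image_iff)
          then show ?thesis
            by (auto simp: diff_in_cube_iff algebra_simps)
        qed
        then show ?thesis by (simp add: C_def)
      qed
      also have "\<dots> \<longleftrightarrow> l = ?n - rep ?c"
      proof
        assume "\<exists>\<kappa>\<in>grpG' M. l = ?n - rep \<kappa>"
        then obtain \<kappa> where k: "\<kappa> \<in> grpG' M" "l = ?n - rep \<kappa>"
          by blast
        have "?n - rep \<kappa> \<in> ?H"
          using l unfolding k(2) .
        then have "?c = \<kappa>"
          using coset_eq_iff[OF H, of ?c UNIV \<kappa> ?n "rep \<kappa>"] c k nc rep_in_coset[OF H]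
          by (simp add: grpG'_coset)
        with k show "l = ?n - rep ?c" by simp
      qed (use c in blast)
      finally show ?thesis .
    qed
    have "?n - rep ?c \<in> ?H"
      using coset_eq_iff[OF H, of ?c UNIV ?c ?n "rep ?c"] c nc rep_in_coset[OF H, of ?c UNIV]
      by (simp add: grpG'_coset)
    moreover have "L = of_int_vec ` ?H"
      by (simp add: L_def image_image)
    ultimately show "\<exists>!l. l \<in> L \<and> x - l \<in> C"
      using iff by auto
  qed
  have Q: "half_open_cube \<in> sets (lebesgue :: (real ^ 'd) measure)"
    "emeasure lebesgue (half_open_cube :: (real ^ 'd) set) = 1"
    using lmeasurable_half_open_cube emeasure_eq_measure2[OF lmeasurable_half_open_cube]
    by (auto simp: measure_half_open_cube)
  have D: "D \<in> lmeasurable" "measure lebesgue D = \<bar>of_int (det M)\<bar>"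
    using linear_image_volume[of "(*v) R", OF _ lmeasurable_half_open_cube]
    by (auto simp: D_def measure_half_open_cube detR)
  have count: "countable (grpG' M)"
    by (simp add: grpG'_coset quotient_def)
  have Cs: "C \<in> sets lebesgue"
    unfolding C_def using count Q lebesgue_sets_translation by (intro sets.countable_UN'') auto
  have "emeasure lebesgue C =
      (\<integral>\<^sup>+\<kappa>. emeasure lebesgue ((+) (of_int_vec (rep \<kappa>)) ` (half_open_cube :: (real ^ 'd) set))
        \<partial>count_space (grpG' M))"
    unfolding C_def
  proof (rule emeasure_UN_countable)
    show "disjoint_family_on (\<lambda>\<kappa>. (+) (of_int_vec (rep \<kappa>)) ` half_open_cube) (grpG' M)"
    proof -
      have "rep \<kappa> = floor_vec x" if "x \<in> (+) (of_int_vec (rep \<kappa>)) ` half_open_cube"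
        for x and \<kappa> :: "(int ^ 'd) set"
        using that by (auto simp flip: diff_in_cube_iff)
      moreover have "\<kappa> = \<eta>" if "\<kappa> \<in> grpG' M" "\<eta> \<in> grpG' M" "rep \<kappa> = rep \<eta>" for \<kappa> \<eta>
        using coset_eq_iff[OF H, of \<kappa> UNIV \<eta> "rep \<kappa>" "rep \<eta>"] that 
          rep_in_coset[OF H, of \<kappa> UNIV] rep_in_coset[OF H, of \<eta> UNIV] H
        by (simp add: grpG'_coset add_subgroup_def)
      ultimately show ?thesis
        unfolding disjoint_family_on_def by (metis disjoint_iff)
    qed
  qed (use Q count lebesgue_sets_translation in auto)
  also have "\<dots> = emeasure (count_space (grpG' M)) (grpG' M)"
    by (simp add: emeasure_lebesgue_translate Q)
  finally have "emeasure (count_space (grpG' M)) (grpG' M) = emeasure lebesgue D"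
    using tiles_emeasure_eq[OF _ L tC tD Cs] D by (simp add: L_def fmeasurableD)
  also have "\<dots> = ennreal \<bar>of_int (det M)\<bar>"
    using D by (simp add: emeasure_eq_measure2)
  finally have e: "emeasure (count_space (grpG' M)) (grpG' M) = ennreal \<bar>of_int (det M)\<bar>" .
  show fin: "finite (grpG' M)"
    using e by (auto simp: emeasure_count_space split: if_splits)
  have "ennreal (real (card (grpG' M))) = ennreal \<bar>of_int (det M)\<bar>"
    using e fin by (simp add: emeasure_count_space_finite ennreal_of_nat_eq_real_of_nat)
  then have "real (card (grpG' M)) = \<bar>of_int (det M)\<bar>"
    by (simp only: ennreal_inj abs_ge_zero of_nat_0_le_iff)
  then show "int (card (grpG' M)) = \<bar>det M\<bar>"
    by linarith
qed

section \<open>The pairing of the two groups\<close>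

text \<open>
  The points $2 \pi M^{-T} k$, whose classes modulo $2 \pi \mathbb{Z}^d$ form the group $G$.
\<close>

definition dual_point :: "int ^ 'd ^ 'd::finite \<Rightarrow> int ^ 'd \<Rightarrow> real ^ 'd" where
  "dual_point M k =
     (2 * pi) *\<^sub>R (transpose (matrix_inv (map_matrix real_of_int M)) *v of_int_vec k)"

definition period_lattice :: "(real ^ 'd::finite) set" where
  "period_lattice = range (\<lambda>k. (2 * pi) *\<^sub>R of_int_vec k)"

lemma int_lattice_eq: "int_lattice = range of_int_vec"
  by (simp add: int_lattice_def of_int_vec_def)

lemma grpG_coset_rel:
  fixes M :: "int ^ 'd ^ 'd::finite"
  shows "grpG M = range (dual_point M) // coset_rel period_lattice"
proof -
  have "{(s :: real ^ 'd, t). \<exists>k\<in>int_lattice. s - t = (2 * pi) *\<^sub>R k} = coset_rel period_lattice"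
    by (auto simp: coset_rel_def int_lattice_eq period_lattice_def)
  moreover have "{(2 * pi) *\<^sub>R (transpose (matrix_inv (map_matrix real_of_int M)) *v k) |k.
      k \<in> int_lattice} = range (dual_point M)"
    by (auto simp: dual_point_def int_lattice_eq)
  ultimately show ?thesis
    by (simp only: grpG_def)
qed

lemma
  assumes "invertible A"
  shows matrix_inv_right: "A ** matrix_inv A = mat 1"
    and matrix_inv_left: "matrix_inv A ** A = mat 1"
  using someI_ex[OF assms[unfolded invertible_def]] by (simp_all add: matrix_inv_def)

lemma add_subgroup_period_lattice: "add_subgroup period_lattice"
  by (auto simp: add_subgroup_def period_lattice_def image_iff
      simp flip: scaleR_right_diff_distrib of_int_vec_diff intro: exI[of _ 0])

lemma dual_point_diff: "dual_point M (k - l) = dual_point M k - dual_point M l"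
  by (simp add: dual_point_def of_int_vec_diff matrix_vector_mult_diff_distrib scaleR_right_diff_distrib)

lemma add_subgroup_dual_points: "add_subgroup (range (dual_point M))"
proof -
  have "dual_point M 0 = 0"
    by (simp add: dual_point_def)
  then show ?thesis
    by (auto simp: add_subgroup_def image_iff simp flip: dual_point_diff intro: exI[of _ 0])
qed

lemma trig_inner: "trig \<alpha> s = exp (- \<i> * complex_of_real (of_int_vec \<alpha> \<bullet> s))"
  by (simp add: trig_def inner_vec_def)

lemma trig_add_left: "trig (\<alpha> + \<beta>) s = trig \<alpha> s * trig \<beta> s"
  by (simp add: trig_inner of_int_vec_add inner_add_left ring_distribs flip: exp_add)

lemma trig_diff_left: "trig (\<alpha> - \<beta>) s = trig \<alpha> s * cnj (trig \<beta> s)"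
  by (simp add: trig_inner of_int_vec_diff inner_diff_left ring_distribs exp_cnj flip: exp_add)

lemma trig_diff_right: "trig \<alpha> (s - t) = cnj (trig \<alpha> t) * trig \<alpha> s"
  by (simp add: trig_inner inner_diff_right ring_distribs exp_cnj flip: exp_add)

lemma exp_2pi_eq_1_iff: "exp (- \<i> * complex_of_real (2 * pi * x)) = 1 \<longleftrightarrow> x \<in> \<int>"
proof -
  have "exp (- \<i> * complex_of_real (2 * pi * x)) = 1 \<longleftrightarrow> (\<exists>n::int. - (2 * pi * x) = of_int (2 * n) * pi)"
    by (simp add: exp_eq_1)
  also have "\<dots> \<longleftrightarrow> (\<exists>n::int. x = of_int (- n))"
  proof (intro ex_cong1)
    fix n :: int
    have "- (2 * pi * x) = of_int (2 * n) * pi \<longleftrightarrow> (- 2 * pi) * x = (- 2 * pi) * of_int (- n)"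
      by auto
    also have "\<dots> \<longleftrightarrow> x = of_int (- n)"
      by (subst mult_cancel_left) simp
    finally show "- (2 * pi * x) = of_int (2 * n) * pi \<longleftrightarrow> x = of_int (- n)" .
  qed
  also have "\<dots> \<longleftrightarrow> x \<in> \<int>"
    by (metis Ints_cases Ints_of_int add.inverse_inverse)
  finally show ?thesis .
qed

lemma trig_dual_point:
  "trig \<alpha> (dual_point M k) = exp (- \<i> * complex_of_real
     (2 * pi * ((matrix_inv (map_matrix real_of_int M) *v of_int_vec \<alpha>) \<bullet> of_int_vec k)))"
  unfolding trig_inner dual_point_def inner_scaleR_right dot_lmul_matrix[symmetric]
    vector_transpose_matrix ..

lemma axis_eq_of_int_vec: "of_int_vec (axis j 1) = axis j 1"
  by (simp add: vec_eq_iff axis_def)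

text \<open>
  Nondegeneracy on the side of the exponents: the characters take the values
  $e^{-2 \pi i (M^{-1} \alpha) \cdot k}$, and these are all $1$ only if $M^{-1} \alpha$ is an integer vector.
\<close>

lemma trig_dual_points_trivial_iff:
  assumes "det M \<noteq> 0"
  shows "(\<forall>s\<in>range (dual_point M). trig \<alpha> s = 1) \<longleftrightarrow> \<alpha> \<in> range ((*v) M)"
proof -
  let ?R = "map_matrix real_of_int M"
  let ?b = "matrix_inv ?R *v of_int_vec \<alpha>"
  have inv: "invertible ?R"
    using assms by (simp add: invertible_det_nz det_of_int)
  have "(\<forall>s\<in>range (dual_point M). trig \<alpha> s = 1) \<longleftrightarrow> (\<forall>k. ?b \<bullet> of_int_vec k \<in> \<int>)"
    by (simp only: ball_simps trig_dual_point exp_2pi_eq_1_iff)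
  also have "\<dots> \<longleftrightarrow> (\<forall>j. ?b $ j \<in> \<int>)"
  proof safe
    fix j assume "\<forall>k. ?b \<bullet> of_int_vec k \<in> \<int>"
    then show "?b $ j \<in> \<int>"
      by (metis axis_eq_of_int_vec cart_eq_inner_axis)
  next
    fix k assume "\<forall>j. ?b $ j \<in> \<int>"
    then show "?b \<bullet> of_int_vec k \<in> \<int>"
      unfolding inner_vec_def by (auto intro!: Ints_sum Ints_mult)
  qed
  also have "\<dots> \<longleftrightarrow> (\<exists>k. ?b = of_int_vec k)"
  proof
    assume "\<forall>j. ?b $ j \<in> \<int>"
    then have "?b = of_int_vec (floor_vec ?b)"
      by (simp add: vec_eq_iff floor_vec_def)
    then show "\<exists>k. ?b = of_int_vec k" ..
  qed auto
  also have "\<dots> \<longleftrightarrow> (\<exists>k. of_int_vec \<alpha> = ?R *v of_int_vec k)"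
    by (metis inv matrix_inv_left matrix_inv_right matrix_vector_mul_assoc matrix_vector_mul_lid)
  also have "\<dots> \<longleftrightarrow> \<alpha> \<in> range ((*v) M)"
    by (auto simp flip: of_int_vec_mult)
  finally show ?thesis .
qed

text \<open>
  Nondegeneracy on the side of the frequencies: the unit vectors as exponents detect each coordinate
  modulo $2 \pi$.
\<close>

lemma trig_trivial_iff: "(\<forall>\<alpha>. trig \<alpha> s = 1) \<longleftrightarrow> s \<in> period_lattice"
proof
  assume triv: "\<forall>\<alpha>. trig \<alpha> s = 1"
  have "s $ j / (2 * pi) \<in> \<int>" for j
    using triv[rule_format, of "axis j 1"] exp_2pi_eq_1_iff[of "s $ j / (2 * pi)"]
    by (simp add: trig_inner axis_eq_of_int_vec cart_eq_inner_axis inner_commute)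
  then have "s = (2 * pi) *\<^sub>R of_int_vec (floor_vec ((1 / (2 * pi)) *\<^sub>R s))"
    by (simp add: vec_eq_iff floor_vec_def)
  then show "s \<in> period_lattice"
    unfolding period_lattice_def by blast
next
  assume "s \<in> period_lattice"
  then obtain k where "s - 0 = (2 * pi) *\<^sub>R of_int_vec k"
    by (auto simp: period_lattice_def)
  then show "\<forall>\<alpha>. trig \<alpha> s = 1"
    using trig_period[of s 0 "of_int_vec k"] by (simp add: int_lattice_eq trig_def)
qed

lemma
  assumes "\<And>x y. f x = f y \<longleftrightarrow> g x = g y"
  shows finite_range_cong: "finite (range f) \<longleftrightarrow> finite (range g)"
    and card_range_cong: "card (range f) = card (range g)"
proof -
  have "bij_betw (\<lambda>c. g (SOME x. f x = c)) (range f) (range g)"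
  proof (rule bij_betw_imageI)
    have g: "g (SOME y. f y = f x) = g x" for x
      using someI[of "\<lambda>y. f y = f x" x] assms by blast
    show "inj_on (\<lambda>c. g (SOME x. f x = c)) (range f)"
      by (auto intro!: inj_onI simp: g) (simp add: assms)
    show "(\<lambda>c. g (SOME x. f x = c)) ` range f = range g"
      by (simp add: image_image g)
  qed
  then show "finite (range f) \<longleftrightarrow> finite (range g)" "card (range f) = card (range g)"
    by (auto simp: bij_betw_finite bij_betw_same_card)
qed

lemma dual_point_period_iff:
  assumes "det M \<noteq> 0"
  shows "dual_point M k \<in> period_lattice \<longleftrightarrow> k \<in> range ((*v) (transpose M))"
proof -
  let ?R = "map_matrix real_of_int M"
  have inv: "invertible ?R"
    using assms by (simp add: invertible_det_nz det_of_int)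
  have "transpose (matrix_inv ?R) ** transpose ?R = mat 1"
    "transpose ?R ** transpose (matrix_inv ?R) = mat 1"
    using matrix_inv_left[OF inv] matrix_inv_right[OF inv]
    by (simp_all flip: matrix_transpose_mul)
  then have "transpose (matrix_inv ?R) *v x = y \<longleftrightarrow> x = transpose ?R *v y" for x y
    by (metis matrix_vector_mul_assoc matrix_vector_mul_lid)
  moreover have "transpose ?R = map_matrix real_of_int (transpose M)"
    by (simp add: transpose_def vec_eq_iff)
  ultimately show ?thesis
    by (auto simp: dual_point_def period_lattice_def of_int_vec_mult[symmetric] image_iff)
qed

text \<open>
  The map $k \mapsto 2 \pi M^{-T} k$ induces a bijection from $\mathbb{Z}^d / M^T \mathbb{Z}^d$ to $G$, and
  $\det M^T = \det M$.
\<close>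

lemma
  fixes M :: "int ^ 'd ^ 'd::finite"
  assumes det: "det M \<noteq> 0"
  shows finite_grpG: "finite (grpG M)"
    and card_grpG: "int (card (grpG M)) = \<bar>det M\<bar>"
proof -
  let ?f = "\<lambda>k. coset_rel period_lattice `` {dual_point M k}"
  let ?g = "\<lambda>k. coset_rel (range ((*v) (transpose M))) `` {k}"
  have coset_iff: "coset_rel H `` {x} = coset_rel H `` {y} \<longleftrightarrow> x - y \<in> H" if "add_subgroup H"
    for H :: "'a::ab_group_add set" and x y
    using eq_equiv_class_iff[OF equiv_coset_rel[OF that]] by (simp add: coset_rel_def)
  have "?f k = ?f l \<longleftrightarrow> ?g k = ?g l" for k l
    by (simp add: coset_iff add_subgroup_period_lattice add_subgroup_range_mult
        dual_point_period_iff[OF det] del: transpose_matrix_vector flip: dual_point_diff)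
  note range_cong = finite_range_cong[of ?f ?g, OF this] card_range_cong[of ?f ?g, OF this]
  have "grpG M = range ?f" "grpG' (transpose M) = range ?g"
    by (auto simp: grpG_coset_rel grpG'_coset quotient_def)
  with range_cong show "finite (grpG M)" "int (card (grpG M)) = \<bar>det M\<bar>"
    using finite_lattice_cosets[of "transpose M"] card_lattice_cosets[of "transpose M"] det
    by (simp_all add: det_transpose)
qed

text \<open>
  This makes the pairing well defined on cosets of $M \mathbb{Z}^d$, so that it may be evaluated at
  representatives.
\<close>

lemma trig_lattice_trivial:
  fixes M :: "int ^ 'd ^ 'd::finite"
  assumes det: "det M \<noteq> 0" and \<sigma>: "\<sigma> \<in> grpG M" and h: "h \<in> range ((*v) M)"
  shows "trig h (rep \<sigma>) = 1"
proof -
  note P = add_subgroup_period_lattice[where 'a = 'd]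
  obtain k where "\<sigma> = coset_rel period_lattice `` {dual_point M k}"
    using \<sigma> unfolding grpG_coset_rel quotient_def by blast
  then have "dual_point M k \<in> \<sigma>"
    using P by (simp add: coset_rel_def add_subgroup_def)
  moreover have "rep \<sigma> \<in> \<sigma>"
    using rep_in_coset[OF P] \<sigma> unfolding grpG_coset_rel by blast
  ultimately show ?thesis
    using grpG_coset[OF \<sigma>] trig_dual_points_trivial_iff[OF det, of h] h
    by (metis rangeI)
qed

text \<open>
  The product of one character with the conjugate of another is the character of the difference of the
  exponents. It is constantly $1$ for equal cosets and nontrivial on $G$ otherwise, by nondegeneracy.
\<close>

lemma character_orthogonality_G:
  fixes M :: "int ^ 'd ^ 'd::finite"
  assumes det: "det M \<noteq> 0" and "\<kappa> \<in> grpG' M" "\<eta> \<in> grpG' M"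
  shows "(\<Sum>\<sigma>\<in>grpG M. trig (rep \<kappa>) (rep \<sigma>) * cnj (trig (rep \<eta>) (rep \<sigma>)))
    = (if \<kappa> = \<eta> then of_int \<bar>det M\<bar> else 0)"
proof -
  let ?\<alpha> = "rep \<kappa> - rep \<eta>"
  have eq: "\<kappa> = \<eta> \<longleftrightarrow> ?\<alpha> \<in> range ((*v) M)"
    using coset_eq_iff[OF add_subgroup_range_mult] rep_in_coset[OF add_subgroup_range_mult] assms(2,3)
    unfolding grpG'_coset by blast
  have "(\<Sum>\<sigma>\<in>grpG M. trig ?\<alpha> (rep \<sigma>)) = (if \<kappa> = \<eta> then of_int \<bar>det M\<bar> else 0)"
  proof (cases "\<kappa> = \<eta>")
    case True
    then show ?thesis
      using arg_cong[OF card_grpG[OF det], of "of_int :: int \<Rightarrow> complex"] by (simp add: trig_def)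
  next
    case False
    then obtain s where "s \<in> range (dual_point M)" "trig ?\<alpha> s \<noteq> 1"
      using eq trig_dual_points_trivial_iff[OF det, of ?\<alpha>] by blast
    then show ?thesis
      using character_sum[OF add_subgroup_dual_points add_subgroup_period_lattice, of "trig ?\<alpha>" s M]
        trig_trivial_iff trig_add False by (metis grpG_coset_rel)
  qed
  then show ?thesis
    by (simp add: trig_diff_left)
qed

text \<open>
  The same argument with the roles of exponents and frequencies exchanged.
\<close>

lemma character_orthogonality_G':
  fixes M :: "int ^ 'd ^ 'd::finite"
  assumes det: "det M \<noteq> 0" and "\<sigma> \<in> grpG M" "\<tau> \<in> grpG M"
  shows "(\<Sum>\<kappa>\<in>grpG' M. cnj (trig (rep \<kappa>) (rep \<sigma>)) * trig (rep \<kappa>) (rep \<tau>))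
    = (if \<sigma> = \<tau> then of_int \<bar>det M\<bar> else 0)"
proof -
  let ?s = "rep \<tau> - rep \<sigma>"
  note P = add_subgroup_period_lattice
  have rep: "rep \<sigma> \<in> \<sigma>" "rep \<tau> \<in> \<tau>"
    using rep_in_coset[OF P] assms(2,3) unfolding grpG_coset_rel by blast+
  have eq: "\<sigma> = \<tau> \<longleftrightarrow> ?s \<in> period_lattice"
    using coset_eq_iff[OF P _ _ rep(2,1)] assms(2,3) unfolding grpG_coset_rel by blast
  have "(\<Sum>\<kappa>\<in>grpG' M. trig (rep \<kappa>) ?s) = (if \<sigma> = \<tau> then of_int \<bar>det M\<bar> else 0)"
  proof (cases "\<sigma> = \<tau>")
    case True
    then show ?thesis
      using arg_cong[OF card_lattice_cosets[OF det], of "of_int :: int \<Rightarrow> complex"]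
      by (simp add: trig_def)
  next
    case False
    then obtain \<alpha> where \<alpha>: "trig \<alpha> ?s \<noteq> 1"
      using eq trig_trivial_iff by blast
    have triv: "trig h ?s = 1" if "h \<in> range ((*v) M)" for h
      using trig_lattice_trivial[OF det _ that] assms(2,3) by (simp add: trig_diff_right)
    have "add_subgroup (UNIV :: (int ^ 'd) set)"
      by (simp add: add_subgroup_def)
    then show ?thesis
      using character_sum[OF _ add_subgroup_range_mult, of UNIV "\<lambda>\<alpha>. trig \<alpha> ?s" M \<alpha>]
        \<alpha> triv False by (simp add: trig_add_left grpG'_coset)
  qed
  then show ?thesis
    by (simp add: trig_diff_right)
qed

section \<open>Laurent polynomials and their isotypical components\<close>

lemma lconst_0 [simp]: "lconst 0 = 0"
  by (simp add: lconst_def)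

lemma lconst_1 [simp]: "lconst 1 = 1"
  by (simp add: lconst_def)

lemma lconst_mult: "lconst (a * b) = lconst a * lconst b"
  by (simp add: lconst_def mult_single)

lemma lconst_add: "lconst (a + b) = lconst a + lconst b"
  by (simp add: lconst_def single_add)

lemma lconst_sum: "lconst (\<Sum>i\<in>I. f i) = (\<Sum>i\<in>I. lconst (f i))"
  by (induction I rule: infinite_finite_induct) (simp_all add: lconst_add)

lemma lcoeff_lconst_mult: "lcoeff (lconst c * q) \<alpha> = c * lcoeff q \<alpha>"
  unfolding lconst_def
  by (simp flip: mult_map_scale_conv_mult) (simp add: Poly_Mapping.map.rep_eq when_def)

lemma lconst_lmonom: "lconst c * lmonom \<alpha> = Poly_Mapping.single \<alpha> c"
  by (simp add: lconst_def lmonom_def mult_single)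

lemma lstar_lconst_mult: "lstar (lconst c * q) = lconst (cnj c) * lstar q"
  by (rule poly_mapping_eqI) (simp add: lcoeff_lstar lcoeff_lconst_mult)

lemma lstar_sum: "lstar (\<Sum>i\<in>I. f i) = (\<Sum>i\<in>I. lstar (f i))"
  by (rule poly_mapping_eqI) (simp add: lcoeff_lstar lookup_sum)

lemma lstar_single: "lstar (Poly_Mapping.single \<alpha> c) = Poly_Mapping.single (- \<alpha>) (cnj c)"
  by (rule poly_mapping_eqI) (auto simp: lcoeff_lstar lookup_single when_def)

lemma lcoeff_vdot: "finite S \<Longrightarrow> lcoeff (vdot S v) \<alpha> = (if \<alpha> \<in> S then v \<alpha> else 0)"
  by (simp add: vdot_def lconst_lmonom lookup_sum lookup_single when_def sum.delta')

lemma vdot_lcoeff: "finite S \<Longrightarrow> {\<alpha>. lcoeff p \<alpha> \<noteq> 0} \<subseteq> S \<Longrightarrow> vdot S (lcoeff p) = p"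
  by (rule poly_mapping_eqI) (auto simp: lcoeff_vdot)

text \<open>
  Each exponent lies in exactly one coset, and the shift by \<open>\<sigma>\<close> multiplies all coefficients in that coset
  by the same number.
\<close>

lemma lshift_vdot:
  assumes "finite S" "finite (grpG' M)" "\<sigma> \<in> grpG M" "det M \<noteq> 0"
  shows "lshift (vdot S v) \<sigma> = (\<Sum>\<kappa>\<in>grpG' M. lconst (trig (rep \<kappa>) (rep \<sigma>)) * vdot (S \<inter> \<kappa>) v)"
proof (rule poly_mapping_eqI)
  fix \<alpha>
  let ?H = "range ((*v) M)" and ?c = "coset_rel (range ((*v) M)) `` {\<alpha>}"
  note H = add_subgroup_range_mult[of M] and P = add_subgroup_period_lattice
  have c: "?c \<in> grpG' M"
    by (simp add: grpG'_coset quotientI)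
  have \<alpha>: "\<alpha> \<in> ?c"
    using H by (simp add: coset_rel_def add_subgroup_def)
  have unique: "\<alpha> \<in> \<kappa> \<longleftrightarrow> \<kappa> = ?c" if "\<kappa> \<in> grpG' M" for \<kappa>
  proof
    assume "\<alpha> \<in> \<kappa>"
    then show "\<kappa> = ?c"
      using coset_eq_iff[OF H, of \<kappa> UNIV ?c \<alpha> \<alpha>] that c \<alpha> H
      by (simp add: grpG'_coset add_subgroup_def)
  qed (use \<alpha> in simp)
  have rep: "rep \<sigma> \<in> \<sigma>"
    using rep_in_coset[OF P] assms(3) unfolding grpG_coset_rel by blast
  have "trig \<alpha> (rep \<sigma>) = trig (rep ?c) (rep \<sigma>)"
    using trig_lattice_trivial[OF assms(4,3), of "\<alpha> - rep ?c"] coset_eq_iff[OF H, of ?c UNIV ?c \<alpha> "rep ?c"]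
      c \<alpha> rep_in_coset[OF H, of ?c UNIV] trig_add_left[of "\<alpha> - rep ?c" "rep ?c" "rep \<sigma>"]
    by (simp add: grpG'_coset)
  then show "lcoeff (lshift (vdot S v) \<sigma>) \<alpha>
      = lcoeff (\<Sum>\<kappa>\<in>grpG' M. lconst (trig (rep \<kappa>) (rep \<sigma>)) * vdot (S \<inter> \<kappa>) v) \<alpha>"
    using assms(1,2) c
    by (simp add: lcoeff_lshift[OF assms(3) rep] lookup_sum lcoeff_lconst_mult lcoeff_vdot unique
        if_distrib[of "\<lambda>x. _ * x"] sum.delta conj_commute cong: if_cong conj_cong sum.cong)
qed

section \<open>Fourier inversion\<close>

text \<open>
  One-sided inversion of a linear transform, with coefficients in the Laurent polynomial ring. A double
  transform is inverted by using it once for each index.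
\<close>

lemma fourier_half_inversion:
  assumes "finite I" "a \<in> I"
    and "\<And>x. x \<in> I \<Longrightarrow> (\<Sum>s\<in>J. A s * B s x) = (if x = a then c else 0)"
  shows "(\<Sum>s\<in>J. lconst (A s) * (\<Sum>x\<in>I. lconst (B s x) * Z x)) = lconst c * Z a"
proof -
  have "(\<Sum>s\<in>J. lconst (A s) * (\<Sum>x\<in>I. lconst (B s x) * Z x))
      = (\<Sum>x\<in>I. lconst (\<Sum>s\<in>J. A s * B s x) * Z x)"
    unfolding sum_distrib_left lconst_sum sum_distrib_right
    by (subst sum.swap) (simp add: lconst_mult mult.assoc)
  also have "\<dots> = (\<Sum>x\<in>I. if x = a then lconst c * Z x else 0)"
    by (rule sum.cong) (simp_all add: assms(3))
  also have "\<dots> = lconst c * Z a"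
    using assms(1,2) by simp
  finally show ?thesis .
qed

text \<open>
  With $E = (e_{x,s})$ the hypotheses read $E E^* = c I$, $E^* E = c I$ and $Y = E^* X E$. Hence $X = I/c$ gives $Y = I$, and $Y = I$ gives $c^2 X = E E^* = c I$.
\<close>

lemma fourier_inversion:
  fixes X :: "'a \<Rightarrow> 'a \<Rightarrow> 'd::finite laurent"
  assumes "finite I" "finite J" "c \<noteq> 0"
    and row: "\<And>x y. x \<in> I \<Longrightarrow> y \<in> I \<Longrightarrow> (\<Sum>s\<in>J. e x s * cnj (e y s)) = (if x = y then c else 0)"
    and col: "\<And>s t. s \<in> J \<Longrightarrow> t \<in> J \<Longrightarrow> (\<Sum>x\<in>I. cnj (e x s) * e x t) = (if s = t then c else 0)"
    and Y: "\<And>s t. s \<in> J \<Longrightarrow> t \<in> J \<Longrightarrow>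
      Y s t = (\<Sum>x\<in>I. lconst (cnj (e x s)) * (\<Sum>y\<in>I. lconst (e y t) * X x y))"
  shows "(\<forall>x\<in>I. \<forall>y\<in>I. X x y = (if x = y then lconst (1 / c) else 0))
    \<longleftrightarrow> (\<forall>s\<in>J. \<forall>t\<in>J. Y s t = (if s = t then 1 else 0))"
proof safe
  fix s t
  assume X: "\<forall>x\<in>I. \<forall>y\<in>I. X x y = (if x = y then lconst (1 / c) else 0)" and st: "s \<in> J" "t \<in> J"
  have "(\<Sum>y\<in>I. lconst (e y t) * X x y) = lconst (e x t / c)" if "x \<in> I" for x
  proof -
    have "(\<Sum>y\<in>I. lconst (e y t) * X x y) = (\<Sum>y\<in>I. if x = y then lconst (e y t) * lconst (1 / c) else 0)"
      using X that by (intro sum.cong) auto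
    then show ?thesis
      using assms(1) that by (simp flip: lconst_mult)
  qed
  then have "Y s t = (\<Sum>x\<in>I. lconst (cnj (e x s)) * lconst (e x t / c))"
    unfolding Y[OF st] by (intro sum.cong) auto
  also have "\<dots> = lconst ((\<Sum>x\<in>I. cnj (e x s) * e x t) / c)"
    by (simp add: lconst_sum sum_divide_distrib flip: lconst_mult)
  also have "\<dots> = (if s = t then 1 else 0)"
    using col[OF st] \<open>c \<noteq> 0\<close> by simp
  finally show "Y s t = (if s = t then 1 else 0)" .
next
  fix a b
  assume Y1: "\<forall>s\<in>J. \<forall>t\<in>J. Y s t = (if s = t then 1 else 0)" and ab: "a \<in> I" "b \<in> I"
  have rows: "(\<Sum>s\<in>J. lconst (e a s) * Y s t) = lconst c * (\<Sum>y\<in>I. lconst (e y t) * X a y)"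
    if "t \<in> J" for t
  proof -
    have "(\<Sum>s\<in>J. lconst (e a s) * Y s t)
        = (\<Sum>s\<in>J. lconst (e a s) * (\<Sum>x\<in>I. lconst (cnj (e x s)) * (\<Sum>y\<in>I. lconst (e y t) * X x y)))"
      using Y that by (intro sum.cong) auto
    also have "\<dots> = lconst c * (\<Sum>y\<in>I. lconst (e y t) * X a y)"
      by (rule fourier_half_inversion[OF assms(1) ab(1)]) (use row[OF ab(1)] in auto)
    finally show ?thesis .
  qed
  have cols: "(\<Sum>t\<in>J. lconst (cnj (e b t)) * (\<Sum>y\<in>I. lconst (e y t) * X a y)) = lconst c * X a b"
    by (rule fourier_half_inversion[OF assms(1) ab(2)])
      (use row[OF _ ab(2)] in \<open>auto simp: mult.commute\<close>)
  have "(\<Sum>s\<in>J. lconst (e a s) * Y s t) = lconst (e a t)" if "t \<in> J" for t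
  proof -
    have "(\<Sum>s\<in>J. lconst (e a s) * Y s t) = (\<Sum>s\<in>J. if s = t then lconst (e a s) else 0)"
      using Y1 that by (intro sum.cong) auto
    then show ?thesis
      using assms(2) that by simp
  qed
  then have "(\<Sum>t\<in>J. lconst (cnj (e b t)) * lconst (e a t))
      = (\<Sum>t\<in>J. lconst (cnj (e b t)) * (lconst c * (\<Sum>y\<in>I. lconst (e y t) * X a y)))"
    using rows by (intro sum.cong) auto
  also have "\<dots> = lconst c * (lconst c * X a b)"
    unfolding cols[symmetric] by (simp add: sum_distrib_left mult_ac)
  finally have "lconst (if a = b then c else 0) = lconst c * (lconst c * X a b)"
    unfolding row[OF ab, symmetric] by (simp add: lconst_sum mult.commute flip: lconst_mult)
  then have "lconst (1 / c) * lconst (1 / c) * lconst (if a = b then c else 0)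
      = lconst (1 / c) * lconst (1 / c) * (lconst c * lconst c) * X a b"
    by (simp add: mult.assoc)
  then show "X a b = (if a = b then lconst (1 / c) else 0)"
    using \<open>c \<noteq> 0\<close> by (simp flip: lconst_mult split: if_splits)
qed

section \<open>The two conditions\<close>

lemma mmult_Emat:
  assumes "finite S" "\<alpha> \<in> S" "\<beta> \<in> S"
  shows "mmult S (Emat \<kappa>) (mmult S A (Emat \<eta>)) \<alpha> \<beta> = (if \<alpha> \<in> \<kappa> \<and> \<beta> \<in> \<eta> then A \<alpha> \<beta> else 0)"
proof -
  have left: "mmult S (Emat \<kappa>) B \<alpha> \<beta> = (if \<alpha> \<in> \<kappa> then B \<alpha> \<beta> else 0)" for B
  proof -
    have "mmult S (Emat \<kappa>) B \<alpha> \<beta>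
        = (\<Sum>\<gamma>\<in>S. if \<gamma> = \<alpha> then if \<alpha> \<in> \<kappa> then B \<gamma> \<beta> else 0 else 0)"
      unfolding mmult_def by (intro sum.cong) (auto simp: Emat_def diagm_def)
    then show ?thesis
      using assms by simp
  qed
  have "mmult S A (Emat \<eta>) \<alpha> \<beta>
      = (\<Sum>\<gamma>\<in>S. if \<gamma> = \<beta> then if \<beta> \<in> \<eta> then A \<alpha> \<gamma> else 0 else 0)"
    unfolding mmult_def by (intro sum.cong) (auto simp: Emat_def diagm_def)
  then show ?thesis
    using assms by (simp add: left)
qed

lemma xform_Emat:
  assumes "finite S"
  shows "xform S (mmult S (Emat \<kappa>) (mmult S A (Emat \<eta>)))
    = (\<Sum>\<alpha>\<in>S \<inter> \<kappa>. \<Sum>\<beta>\<in>S \<inter> \<eta>. Poly_Mapping.single (\<beta> - \<alpha>) (A \<alpha> \<beta>))"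
proof -
  have "lmonom (- \<alpha>) * lconst c * lmonom \<beta> = Poly_Mapping.single (\<beta> - \<alpha>) c"
    for \<alpha> \<beta> :: "int ^ 'a" and c
    by (simp add: lmonom_def lconst_def mult_single)
  then have "xform S (mmult S (Emat \<kappa>) (mmult S A (Emat \<eta>)))
      = (\<Sum>\<alpha>\<in>S. \<Sum>\<beta>\<in>S. if \<alpha> \<in> \<kappa> then if \<beta> \<in> \<eta> then Poly_Mapping.single (\<beta> - \<alpha>) (A \<alpha> \<beta>) else 0 else 0)"
    unfolding xform_def using assms by (intro sum.cong) (auto simp: mmult_Emat)
  also have "\<dots> = (\<Sum>\<alpha>\<in>S. if \<alpha> \<in> \<kappa> then \<Sum>\<beta>\<in>S. if \<beta> \<in> \<eta> then Poly_Mapping.single (\<beta> - \<alpha>) (A \<alpha> \<beta>) else 0 else 0)"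
    by (intro sum.cong) auto
  finally show ?thesis
    using assms by (simp add: sum.inter_restrict)
qed

text \<open>
  A rank-one matrix $v^* v$ produces a product of two Laurent polynomials; restricting rows and columns to
  cosets restricts the factors to isotypical components.
\<close>

lemma gram_form:
  "(\<Sum>\<alpha>\<in>A. \<Sum>\<beta>\<in>B. Poly_Mapping.single (\<beta> - \<alpha>) (gram v \<alpha> \<beta>)) = lstar (vdot A v) * vdot B v"
  by (simp add: vdot_def lconst_lmonom lstar_sum lstar_single sum_product mult_single gram_def)

lemma single_sum: "Poly_Mapping.single k (\<Sum>i\<in>I. f i) = (\<Sum>i\<in>I. Poly_Mapping.single k (f i))"
  by (induction I rule: infinite_finite_induct) (simp_all add: single_add)

text \<open>
  On the diagonal the monomials cancel, so only a constant remains: the trace of the block.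
\<close>

lemma diag_form:
  assumes "finite S" "\<kappa> \<inter> \<eta> = {} \<or> \<kappa> = \<eta>"
  shows "(\<Sum>\<alpha>\<in>S \<inter> \<kappa>. \<Sum>\<beta>\<in>S \<inter> \<eta>. Poly_Mapping.single (\<beta> - \<alpha>) (diagm f \<alpha> \<beta>))
    = (if \<kappa> = \<eta> then lconst (\<Sum>\<alpha>\<in>S \<inter> \<kappa>. f \<alpha>) else 0)"
proof -
  have "(\<Sum>\<alpha>\<in>S \<inter> \<kappa>. \<Sum>\<beta>\<in>S \<inter> \<eta>. Poly_Mapping.single (\<beta> - \<alpha>) (diagm f \<alpha> \<beta>))
      = (\<Sum>\<alpha>\<in>S \<inter> \<kappa>. \<Sum>\<beta>\<in>S \<inter> \<eta>. if \<alpha> = \<beta> then lconst (f \<alpha>) else 0)"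
    by (intro sum.cong) (auto simp: diagm_def lconst_def)
  also have "\<dots> = (\<Sum>\<alpha>\<in>S \<inter> \<kappa>. if \<alpha> \<in> \<eta> then lconst (f \<alpha>) else 0)"
    using assms(1) by (intro sum.cong) auto
  also have "\<dots> = (if \<kappa> = \<eta> then lconst (\<Sum>\<alpha>\<in>S \<inter> \<kappa>. f \<alpha>) else 0)"
    using assms(2) by (auto simp: lconst_sum intro!: sum.cong sum.neutral split: if_splits)
  finally show ?thesis .
qed

lemma leval_isotyp_1: "leval (isotyp p \<kappa>) 1 = (\<Sum>\<alpha>\<in>Poly_Mapping.keys p \<inter> \<kappa>. lcoeff p \<alpha>)"
proof -
  have l: "lcoeff (isotyp p \<kappa>) \<alpha> = (if \<alpha> \<in> \<kappa> then lcoeff p \<alpha> else 0)" for \<alpha>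
    by (auto simp: isotyp_def lookup_sum lookup_single when_def sum.delta' in_keys_iff)
  then have "Poly_Mapping.keys (isotyp p \<kappa>) = Poly_Mapping.keys p \<inter> \<kappa>"
    by (auto simp: in_keys_iff split: if_splits)
  with l show ?thesis
    by (auto simp: leval_def one_vec_def intro: sum.cong)
qed

text \<open>
  A singular matrix has the eigenvalue $0$.
\<close>

lemma expansive_det_nonzero:
  assumes "expansive M"
  shows "det M \<noteq> 0"
proof
  let ?C = "map_matrix complex_of_int M"
  assume "det M = 0"
  then have "\<not> invertible ?C"
    by (simp add: invertible_det_nz det_of_int)
  then obtain v where "v \<noteq> 0" "?C *v v = 0"
    using matrix_left_invertible_ker[of ?C] invertible_left_inverse[of ?C] by blast
  then show False
    using assms[unfolded expansive_def, rule_format, of v 0] by simp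
qed

theorem theorem3p12:
  fixes M :: "int ^ 'd ^ 'd::finite"
    and p :: "'d laurent"
    and \<N> :: "(int ^ 'd) set"
    and N :: nat
  assumes "expansive M"
    and "finite \<N>"
    and "{\<alpha>. lcoeff p \<alpha> \<noteq> 0} \<subseteq> \<N>"
    and "\<forall>\<kappa>\<in>grpG' M. leval (isotyp p \<kappa>) 1 = 1 / complex_of_int \<bar>det M\<bar>"
  shows
    "(\<exists>q :: nat \<Rightarrow> int ^ 'd \<Rightarrow> complex. \<forall>\<kappa>\<in>grpG' M. \<forall>\<eta>\<in>grpG' M.
        xform \<N>
          (mmult \<N> (Emat \<kappa>)
            (mmult \<N>
              (\<lambda>\<alpha> \<beta>. diagm (\<lambda>\<gamma>. complex_of_real (Re (lcoeff p \<gamma>))) \<alpha> \<beta>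
                 - gram (lcoeff p) \<alpha> \<beta> - (\<Sum>j = 1..N. gram (q j) \<alpha> \<beta>))
              (Emat \<eta>))) = 0)
     \<longleftrightarrow>
     (\<exists>q :: nat \<Rightarrow> int ^ 'd \<Rightarrow> complex. \<forall>\<sigma>\<in>grpG M. \<forall>\<tau>\<in>grpG M.
        (if \<sigma> = \<tau> then 1 else 0) - lstar (lshift p \<sigma>) * lshift p \<tau>
          = (\<Sum>j = 1..N. lstar (lshift (vdot \<N> (q j)) \<sigma>) * lshift (vdot \<N> (q j)) \<tau>))"
proof (rule ex_cong1)
  fix q :: "nat \<Rightarrow> int ^ 'd \<Rightarrow> complex"
  have det: "det M \<noteq> 0"
    using expansive_det_nonzero[OF assms(1)] .
  define m where "m = complex_of_int \<bar>det M\<bar>"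
  have "m \<noteq> 0"
    using det by (simp add: m_def)
  note fin = finite_lattice_cosets[OF det] finite_grpG[OF det]
  \<comment> \<open>The polynomial \<open>p\<close> enters both conditions like one more \<open>q j\<close>; it gets the free index \<open>0\<close>.\<close>
  define r where "r j = (if j = 0 then lcoeff p else q j)" for j
  define X where "X \<kappa> \<eta> = (\<Sum>j = 0..N. lstar (vdot (\<N> \<inter> \<kappa>) (r j)) * vdot (\<N> \<inter> \<eta>) (r j))" for \<kappa> \<eta>
  define Y where "Y \<sigma> \<tau> = (\<Sum>j = 0..N. lstar (lshift (vdot \<N> (r j)) \<sigma>) * lshift (vdot \<N> (r j)) \<tau>)"
    for \<sigma> \<tau>
  have split0: "(\<Sum>j = 0..N. f (r j)) = f (lcoeff p) + (\<Sum>j = 1..N. f (q j))"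
    for f :: "(int ^ 'd \<Rightarrow> complex) \<Rightarrow> 'd laurent"
    by (simp add: sum.atLeast_Suc_atMost r_def)
  have "xform \<N> (mmult \<N> (Emat \<kappa>) (mmult \<N>
      (\<lambda>\<alpha> \<beta>. diagm (\<lambda>\<gamma>. complex_of_real (Re (lcoeff p \<gamma>))) \<alpha> \<beta>
         - gram (lcoeff p) \<alpha> \<beta> - (\<Sum>j = 1..N. gram (q j) \<alpha> \<beta>)) (Emat \<eta>)))
      = (if \<kappa> = \<eta> then lconst (1 / m) else 0) - X \<kappa> \<eta>"
    if "\<kappa> \<in> grpG' M" "\<eta> \<in> grpG' M" for \<kappa> \<eta>
  proof -
    have disj: "\<kappa> \<inter> \<eta> = {} \<or> \<kappa> = \<eta>"
      using quotient_disj[OF equiv_coset_rel[OF add_subgroup_range_mult]] that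
      unfolding grpG'_coset by blast
    \<comment> \<open>The value of the isotypical component at 1 is real, so it is unaffected by passing to real parts.\<close>
    have trace: "(\<Sum>\<alpha>\<in>\<N> \<inter> \<kappa>. complex_of_real (Re (lcoeff p \<alpha>))) = 1 / m"
    proof -
      have "(\<Sum>\<alpha>\<in>\<N> \<inter> \<kappa>. lcoeff p \<alpha>) = leval (isotyp p \<kappa>) 1"
        unfolding leval_isotyp_1 using assms(2,3)
        by (intro sum.mono_neutral_right) (auto simp: in_keys_iff)
      also have "\<dots> = complex_of_real (1 / of_int \<bar>det M\<bar>)"
        using assms(4) that by (simp del: of_int_abs)
      finally have "Re (\<Sum>\<alpha>\<in>\<N> \<inter> \<kappa>. lcoeff p \<alpha>) = 1 / of_int \<bar>det M\<bar>"
        by (simp only: Re_complex_of_real)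
      then show ?thesis
        by (simp add: m_def del: of_int_abs flip: of_real_sum)
    qed
    have "(\<Sum>\<alpha>\<in>\<N> \<inter> \<kappa>. \<Sum>\<beta>\<in>\<N> \<inter> \<eta>. Poly_Mapping.single (\<beta> - \<alpha>)
          (diagm (\<lambda>\<gamma>. complex_of_real (Re (lcoeff p \<gamma>))) \<alpha> \<beta>
         - gram (lcoeff p) \<alpha> \<beta> - (\<Sum>j = 1..N. gram (q j) \<alpha> \<beta>)))
        = (if \<kappa> = \<eta> then lconst (1 / m) else 0)
          - lstar (vdot (\<N> \<inter> \<kappa>) (lcoeff p)) * vdot (\<N> \<inter> \<eta>) (lcoeff p)
          - (\<Sum>\<alpha>\<in>\<N> \<inter> \<kappa>. \<Sum>\<beta>\<in>\<N> \<inter> \<eta>. \<Sum>j = 1..N. Poly_Mapping.single (\<beta> - \<alpha>) (gram (q j) \<alpha> \<beta>))"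
      by (simp only: single_diff sum_subtractf gram_form diag_form[OF assms(2) disj] trace single_sum)
    also have "(\<Sum>\<alpha>\<in>\<N> \<inter> \<kappa>. \<Sum>\<beta>\<in>\<N> \<inter> \<eta>. \<Sum>j = 1..N. Poly_Mapping.single (\<beta> - \<alpha>) (gram (q j) \<alpha> \<beta>))
        = (\<Sum>\<alpha>\<in>\<N> \<inter> \<kappa>. \<Sum>j = 1..N. \<Sum>\<beta>\<in>\<N> \<inter> \<eta>. Poly_Mapping.single (\<beta> - \<alpha>) (gram (q j) \<alpha> \<beta>))"
      by (rule sum.cong[OF refl sum.swap])
    also have "\<dots> = (\<Sum>j = 1..N. lstar (vdot (\<N> \<inter> \<kappa>) (q j)) * vdot (\<N> \<inter> \<eta>) (q j))"
      unfolding gram_form[symmetric] by (rule sum.swap)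
    finally show ?thesis
      unfolding xform_Emat[OF assms(2)] X_def
      by (simp only: split0[of "\<lambda>v. lstar (vdot (\<N> \<inter> \<kappa>) v) * vdot (\<N> \<inter> \<eta>) v"] diff_diff_eq)
  qed
  then have i: "(\<forall>\<kappa>\<in>grpG' M. \<forall>\<eta>\<in>grpG' M.
        xform \<N>
          (mmult \<N> (Emat \<kappa>)
            (mmult \<N>
              (\<lambda>\<alpha> \<beta>. diagm (\<lambda>\<gamma>. complex_of_real (Re (lcoeff p \<gamma>))) \<alpha> \<beta>
                 - gram (lcoeff p) \<alpha> \<beta> - (\<Sum>j = 1..N. gram (q j) \<alpha> \<beta>))
              (Emat \<eta>))) = 0)
      \<longleftrightarrow> (\<forall>\<kappa>\<in>grpG' M. \<forall>\<eta>\<in>grpG' M. X \<kappa> \<eta> = (if \<kappa> = \<eta> then lconst (1 / m) else 0))"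
    by (intro ball_cong) auto
  have "Y \<sigma> \<tau> = lstar (lshift p \<sigma>) * lshift p \<tau>
      + (\<Sum>j = 1..N. lstar (lshift (vdot \<N> (q j)) \<sigma>) * lshift (vdot \<N> (q j)) \<tau>)" for \<sigma> \<tau>
    unfolding Y_def split0[of "\<lambda>v. lstar (lshift (vdot \<N> v) \<sigma>) * lshift (vdot \<N> v) \<tau>"]
    by (simp only: vdot_lcoeff[OF assms(2,3)])
  then have ii: "(\<forall>\<sigma>\<in>grpG M. \<forall>\<tau>\<in>grpG M.
        (if \<sigma> = \<tau> then 1 else 0) - lstar (lshift p \<sigma>) * lshift p \<tau>
          = (\<Sum>j = 1..N. lstar (lshift (vdot \<N> (q j)) \<sigma>) * lshift (vdot \<N> (q j)) \<tau>))
      \<longleftrightarrow> (\<forall>\<sigma>\<in>grpG M. \<forall>\<tau>\<in>grpG M. Y \<sigma> \<tau> = (if \<sigma> = \<tau> then 1 else 0))"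
    by (intro ball_cong refl) (simp only: diff_eq_eq eq_commute[of "if _ then _ else _"] add.commute)
  have "Y \<sigma> \<tau> = (\<Sum>\<kappa>\<in>grpG' M. lconst (cnj (trig (rep \<kappa>) (rep \<sigma>))) *
      (\<Sum>\<eta>\<in>grpG' M. lconst (trig (rep \<eta>) (rep \<tau>)) * X \<kappa> \<eta>))"
    if "\<sigma> \<in> grpG M" "\<tau> \<in> grpG M" for \<sigma> \<tau>
  proof -
    have "Y \<sigma> \<tau> = (\<Sum>j = 0..N. \<Sum>\<kappa>\<in>grpG' M. \<Sum>\<eta>\<in>grpG' M. lconst (cnj (trig (rep \<kappa>) (rep \<sigma>))) *
        (lconst (trig (rep \<eta>) (rep \<tau>)) * (lstar (vdot (\<N> \<inter> \<kappa>) (r j)) * vdot (\<N> \<inter> \<eta>) (r j))))"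
      unfolding Y_def
      by (intro sum.cong refl)
        (simp only: lshift_vdot[OF assms(2) fin(1) _ det] that lstar_sum lstar_lconst_mult sum_product
          mult.assoc mult.left_commute[of "lstar _"])
    also have "\<dots> = (\<Sum>\<kappa>\<in>grpG' M. \<Sum>\<eta>\<in>grpG' M. \<Sum>j = 0..N. lconst (cnj (trig (rep \<kappa>) (rep \<sigma>))) *
        (lconst (trig (rep \<eta>) (rep \<tau>)) * (lstar (vdot (\<N> \<inter> \<kappa>) (r j)) * vdot (\<N> \<inter> \<eta>) (r j))))"
      by (subst sum.swap) (intro sum.cong refl sum.swap)
    finally show ?thesis
      by (simp only: X_def sum_distrib_left)
  qed
  from fourier_inversion[where e = "\<lambda>\<kappa> \<sigma>. trig (rep \<kappa>) (rep \<sigma>)", OF fin \<open>m \<noteq> 0\<close>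
      character_orthogonality_G[OF det, folded m_def]
      character_orthogonality_G'[OF det, folded m_def] this]
  show "(\<forall>\<kappa>\<in>grpG' M. \<forall>\<eta>\<in>grpG' M.
        xform \<N>
          (mmult \<N> (Emat \<kappa>)
            (mmult \<N>
              (\<lambda>\<alpha> \<beta>. diagm (\<lambda>\<gamma>. complex_of_real (Re (lcoeff p \<gamma>))) \<alpha> \<beta>
                 - gram (lcoeff p) \<alpha> \<beta> - (\<Sum>j = 1..N. gram (q j) \<alpha> \<beta>))
              (Emat \<eta>))) = 0) \<longleftrightarrow>
     (\<forall>\<sigma>\<in>grpG M. \<forall>\<tau>\<in>grpG M.
        (if \<sigma> = \<tau> then 1 else 0) - lstar (lshift p \<sigma>) * lshift p \<tau>
          = (\<Sum>j = 1..N. lstar (lshift (vdot \<N> (q j)) \<sigma>) * lshift (vdot \<N> (q j)) \<tau>))"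
    unfolding i ii .
qed

end
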